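(* For all $k, m \in \mathbb{N}$, $P_{DP}(K_1 \vee C_{2k+1}, m) = P(K_1 \vee C_{2k+1}, m)$, and \[ P_{DP}(K_1 \vee C_{2k+2}, m) = \begin{cases} 0 & \text{if } m \in \{1,2\},\\ 3 & \text{if } m = 3,\\ P(K_1 \vee C_{2k+2}, m) & \text{if } m \geq 4. \end{cases} \]
   Context: All graphs are finite and simple; $K_1 \vee H$ is the join of a single vertex with $H$ (the cone of $H$), and $C_n$ is the cycle on $n$ vertices. A cover of a graph $G$ is a pair $\mathcal{H}=(L,H)$ where $H$ is a graph and $L: V(G) \to \mathcal{P}(V(H))$ satisfies: (1) $\{L(u): u \in V(G)\}$ is a partition of $V(H)$ into $|V(G)|$ parts; (2) $H[L(u)]$ is complete for each $u$; (3) if there is an edge of $H$ between $L(u)$ and $L(v)$ with $u \neq v$, then $uv \in E(G)$; (4) if $uv \in E(G)$, the edges of $H$ between $L(u)$ and $L(v)$ form a (possibly empty) matching. The cover is $m$-fold if $|L(u)|=m$ for all $u$. An $\mathcal{H}$-coloring of $G$ is an independent set of $H$ of size $|V(G)|$. $P_{DP}(G,m)$ is the minimum number of $\mathcal{H}$-colorings of $G$ over all $m$-fold covers $\mathcal{H}$ of $G$. $P(G,m)$ is the chromatic polynomial of $G$. *)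

theory Defs
  imports Main "HOL-Library.FuncSet" "HOL-Library.Disjoint_Sets"
begin

record 'v graph =
  verts :: "'v set"
  edges :: "'v set set"

definition simple_graph :: "'v graph \<Rightarrow> bool" where
  "simple_graph G \<longleftrightarrow> finite (verts G) \<and> (\<forall>e\<in>edges G. e \<subseteq> verts G \<and> card e = 2)"

definition complete_graph :: "nat \<Rightarrow> nat graph" where
  "complete_graph n = \<lparr>verts = {..<n}, edges = {e. e \<subseteq> {..<n} \<and> card e = 2}\<rparr>"

text \<open>The cycle on \<open>n\<close> vertices; a simple graph and a cycle only for \<open>n \<ge> 3\<close>.\<close>
definition cycle_graph :: "nat \<Rightarrow> nat graph" where
  "cycle_graph n = \<lparr>verts = {..<n}, edges = {{i, (i + 1) mod n} | i. i < n}\<rparr>"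

definition graph_join :: "'a graph \<Rightarrow> 'b graph \<Rightarrow> ('a + 'b) graph" where
  "graph_join G H =
     \<lparr>verts = verts G <+> verts H,
      edges = (\<lambda>e. Inl ` e) ` edges G \<union> (\<lambda>e. Inr ` e) ` edges H
              \<union> {{Inl u, Inr v} | u v. u \<in> verts G \<and> v \<in> verts H}\<rparr>"

definition proper_colorings :: "'v graph \<Rightarrow> nat \<Rightarrow> ('v \<Rightarrow> nat) set" where
  "proper_colorings G m =
     {f \<in> verts G \<rightarrow>\<^sub>E {..<m}. \<forall>u v. {u, v} \<in> edges G \<longrightarrow> f u \<noteq> f v}"

text \<open>The value at \<open>m\<close> of the chromatic polynomial: the number of proper \<open>m\<close>-colorings.\<close>
definition chromatic_poly :: "'v graph \<Rightarrow> nat \<Rightarrow> nat" where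
  "chromatic_poly G m = card (proper_colorings G m)"

definition edges_between :: "'v graph \<Rightarrow> 'v set \<Rightarrow> 'v set \<Rightarrow> 'v set set" where
  "edges_between H A B = {e \<in> edges H. \<exists>x\<in>A. \<exists>y\<in>B. e = {x, y}}"

text \<open>In the last clause, a set of edges is a matching iff its members are pairwise disjoint.\<close>
definition is_cover :: "'v graph \<Rightarrow> ('v \<Rightarrow> 'w set) \<Rightarrow> 'w graph \<Rightarrow> bool" where
  "is_cover G L H \<longleftrightarrow>
     simple_graph H \<and>
     partition_on (verts H) (L ` verts G) \<and> card (L ` verts G) = card (verts G) \<and>
     (\<forall>u\<in>verts G. \<forall>x\<in>L u. \<forall>y\<in>L u. x \<noteq> y \<longrightarrow> {x, y} \<in> edges H) \<and>
     (\<forall>u\<in>verts G. \<forall>v\<in>verts G. u \<noteq> v \<and> edges_between H (L u) (L v) \<noteq> {}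
        \<longrightarrow> {u, v} \<in> edges G) \<and>
     (\<forall>u\<in>verts G. \<forall>v\<in>verts G. {u, v} \<in> edges G \<longrightarrow> disjoint (edges_between H (L u) (L v)))"

definition is_m_fold_cover :: "'v graph \<Rightarrow> nat \<Rightarrow> ('v \<Rightarrow> 'w set) \<Rightarrow> 'w graph \<Rightarrow> bool" where
  "is_m_fold_cover G m L H \<longleftrightarrow> is_cover G L H \<and> (\<forall>u\<in>verts G. card (L u) = m)"

definition independent_set :: "'w graph \<Rightarrow> 'w set \<Rightarrow> bool" where
  "independent_set H I \<longleftrightarrow> I \<subseteq> verts H \<and> (\<forall>x\<in>I. \<forall>y\<in>I. {x, y} \<notin> edges H)"

definition cover_colorings :: "'v graph \<Rightarrow> 'w graph \<Rightarrow> 'w set set" where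
  "cover_colorings G H = {I. independent_set H I \<and> card I = card (verts G)}"

text \<open>The covering graphs range over finite graphs with vertices in \<open>nat\<close>. Every finite graph is
  isomorphic to one of these, so nothing is lost: see \<open>P_DP_le\<close> and \<open>P_DP_attained\<close> below.\<close>
definition P_DP :: "'v graph \<Rightarrow> nat \<Rightarrow> nat" where
  "P_DP G m =
     (LEAST n. \<exists>L (H :: nat graph). is_m_fold_cover G m L H \<and> n = card (cover_colorings G H))"

lemma m_fold_cover_transfer:
  fixes H :: "'w graph"
  assumes cov: "is_m_fold_cover G m L H"
  shows "\<exists>L' (H' :: nat graph). is_m_fold_cover G m L' H' \<and>
           card (cover_colorings G H) = card (cover_colorings G H')"
proof -
  let ?V = "verts H"
  have H: "finite ?V" "\<And>e. e \<in> edges H \<Longrightarrow> e \<subseteq> ?V \<and> card e = 2"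
    and part: "partition_on ?V (L ` verts G)" "card (L ` verts G) = card (verts G)"
    and compl: "\<And>u x y. u \<in> verts G \<Longrightarrow> x \<in> L u \<Longrightarrow> y \<in> L u \<Longrightarrow> x \<noteq> y \<Longrightarrow> {x, y} \<in> edges H"
    and cross: "\<And>u v. u \<in> verts G \<Longrightarrow> v \<in> verts G \<Longrightarrow> u \<noteq> v \<Longrightarrow>
      edges_between H (L u) (L v) \<noteq> {} \<Longrightarrow> {u, v} \<in> edges G"
    and mat: "\<And>u v. u \<in> verts G \<Longrightarrow> v \<in> verts G \<Longrightarrow> {u, v} \<in> edges G \<Longrightarrow>
      disjoint (edges_between H (L u) (L v))"
    and fold: "\<And>u. u \<in> verts G \<Longrightarrow> card (L u) = m"
    using cov by (simp_all add: is_m_fold_cover_def is_cover_def simple_graph_def)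
  obtain g :: "'w \<Rightarrow> nat" where g: "inj_on g ?V"
    using H(1) finite_imp_inj_to_nat_seg by blast
  define L' where "L' u = g ` L u" for u
  define H' where "H' = \<lparr>verts = g ` ?V, edges = (`) g ` edges H\<rparr>"
  have LV: "L u \<subseteq> ?V" if "u \<in> verts G" for u
    using part(1) that by (auto simp: partition_on_def)
  have edge_iff: "g ` A \<in> edges H' \<longleftrightarrow> A \<in> edges H" if "A \<subseteq> ?V" for A
  proof
    assume "g ` A \<in> edges H'"
    then obtain B where "B \<in> edges H" "g ` A = g ` B" unfolding H'_def by auto
    then show "A \<in> edges H" using that H(2) inj_on_image_eq_iff[OF g, of A B] by simp
  qed (simp add: H'_def)
  have edge2: "{g x, g y} \<in> edges H' \<longleftrightarrow> {x, y} \<in> edges H" if "x \<in> ?V" "y \<in> ?V" for x y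
    using edge_iff[of "{x, y}"] that by simp
  have eb: "edges_between H' (L' u) (L' v) = (`) g ` edges_between H (L u) (L v)"
    if uv: "u \<in> verts G" "v \<in> verts G" for u v
  proof (intro equalityI subsetI)
    fix e assume "e \<in> edges_between H' (L' u) (L' v)"
    then obtain x y where xy: "x \<in> L u" "y \<in> L v" "e = {g x, g y}" "e \<in> edges H'"
      unfolding edges_between_def L'_def by auto
    then have "{x, y} \<in> edges H" using edge2 LV uv by blast
    then have "{x, y} \<in> edges_between H (L u) (L v)" using xy unfolding edges_between_def by blast
    moreover have "e = g ` {x, y}" using xy by simp
    ultimately show "e \<in> (`) g ` edges_between H (L u) (L v)" by blast
  next
    fix e assume "e \<in> (`) g ` edges_between H (L u) (L v)"
    then show "e \<in> edges_between H' (L' u) (L' v)"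
      unfolding edges_between_def L'_def H'_def by auto
  qed
  have simple': "simple_graph H'"
    unfolding simple_graph_def H'_def using H by (auto simp: card_image[OF inj_on_subset[OF g]])
  have im: "L' ` verts G = (`) g ` (L ` verts G)" by (auto simp: L'_def)
  have inj_im: "inj_on ((`) g) (Pow ?V)" using g by (rule inj_on_image_Pow)
  have "partition_on (verts H') (L' ` verts G)"
  proof -
    have "{} \<notin> (`) g ` (L ` verts G)" using part(1) by (auto simp: partition_on_def)
    then show ?thesis using partition_on_inj_image[OF part(1) g] by (simp add: im H'_def)
  qed
  moreover have "card (L' ` verts G) = card (verts G)"
  proof -
    have "L ` verts G \<subseteq> Pow ?V" using LV by blast
    then show ?thesis unfolding im part(2)[symmetric] by (intro card_image inj_on_subset[OF inj_im])
  qed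
  moreover have "\<forall>u\<in>verts G. \<forall>x\<in>L' u. \<forall>y\<in>L' u. x \<noteq> y \<longrightarrow> {x, y} \<in> edges H'"
  proof (intro ballI impI)
    fix u p q assume u: "u \<in> verts G" and "p \<in> L' u" "q \<in> L' u" "p \<noteq> q"
    then obtain x y where xy: "x \<in> L u" "y \<in> L u" "p = g x" "q = g y" "x \<noteq> y"
      unfolding L'_def by auto
    then have "x \<in> ?V" "y \<in> ?V" using LV[OF u] by auto
    then show "{p, q} \<in> edges H'" using compl[OF u xy(1,2,5)] edge2 xy(3,4) by simp
  qed
  moreover have "\<forall>u\<in>verts G. \<forall>v\<in>verts G.
      u \<noteq> v \<and> edges_between H' (L' u) (L' v) \<noteq> {} \<longrightarrow> {u, v} \<in> edges G"
    using cross eb by simp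
  moreover have "disjoint (edges_between H' (L' u) (L' v))"
    if "u \<in> verts G" "v \<in> verts G" "{u, v} \<in> edges G" for u v
  proof -
    have "\<Union>(edges_between H (L u) (L v)) \<subseteq> ?V" using H(2) by (auto simp: edges_between_def)
    then show ?thesis
      using mat[OF that] eb[OF that(1,2)] disjoint_image[OF inj_on_subset[OF g]] by simp
  qed
  moreover have "\<forall>u\<in>verts G. card (L' u) = m"
    using fold card_image[OF inj_on_subset[OF g LV]] by (simp add: L'_def)
  ultimately have cov': "is_m_fold_cover G m L' H'"
    using simple' unfolding is_m_fold_cover_def is_cover_def by blast
  have indep: "independent_set H' (g ` I) \<longleftrightarrow> independent_set H I" if "I \<subseteq> ?V" for I
  proof -
    have "g ` I \<subseteq> verts H'" using that by (auto simp: H'_def)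
    moreover have "(\<forall>x\<in>I. \<forall>y\<in>I. {g x, g y} \<notin> edges H') \<longleftrightarrow> (\<forall>x\<in>I. \<forall>y\<in>I. {x, y} \<notin> edges H)"
      using edge2 that by blast
    ultimately show ?thesis using that unfolding independent_set_def by simp
  qed
  have "cover_colorings G H' = (`) g ` cover_colorings G H"
  proof (intro equalityI subsetI)
    fix J assume J: "J \<in> cover_colorings G H'"
    then have "J \<subseteq> g ` ?V" by (auto simp: cover_colorings_def independent_set_def H'_def)
    then obtain I where I: "I \<subseteq> ?V" "J = g ` I" by (auto simp: subset_image_iff)
    then show "J \<in> (`) g ` cover_colorings G H"
      using J indep[OF I(1)] card_image[OF inj_on_subset[OF g I(1)]]
      by (auto simp: cover_colorings_def)
  next
    fix J assume "J \<in> (`) g ` cover_colorings G H"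
    then obtain I where I: "J = g ` I" "independent_set H I" "card I = card (verts G)"
      by (auto simp: cover_colorings_def)
    then have "I \<subseteq> ?V" by (simp add: independent_set_def)
    then show "J \<in> cover_colorings G H'"
      using I indep card_image[OF inj_on_subset[OF g]] by (simp add: cover_colorings_def)
  qed
  moreover have "cover_colorings G H \<subseteq> Pow ?V"
    by (auto simp: cover_colorings_def independent_set_def)
  ultimately have "card (cover_colorings G H) = card (cover_colorings G H')"
    using card_image[OF inj_on_subset[OF inj_im]] by simp
  then show ?thesis using cov' by blast
qed

lemma P_DP_le:
  fixes H :: "'w graph"
  assumes "is_m_fold_cover G m L H"
  shows "P_DP G m \<le> card (cover_colorings G H)"
  using m_fold_cover_transfer[OF assms] unfolding P_DP_def by (auto intro: Least_le)

lemma m_fold_cover_exists: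
  assumes "simple_graph G" "m \<ge> 1"
  shows "\<exists>L (H :: ('v \<times> nat) graph). is_m_fold_cover (G :: 'v graph) m L H"
proof -
  define L where "L u = {u} \<times> {..<m}" for u :: 'v
  define H where "H = \<lparr>verts = verts G \<times> {..<m},
    edges = {{(u, i), (u, j)} | u i j. u \<in> verts G \<and> i < m \<and> j < m \<and> i \<noteq> j}\<rparr>"
  have 1: "simple_graph H" using assms by (auto simp: simple_graph_def H_def)
  have 2: "partition_on (verts H) (L ` verts G)"
  proof -
    have "L u \<noteq> {}" for u using assms(2) by (auto simp: L_def lessThan_empty_iff)
    then have "{} \<notin> L ` verts G" by (metis imageE)
    then show ?thesis by (auto simp: partition_on_def disjoint_def H_def L_def)
  qed
  have 3: "card (L ` verts G) = card (verts G)"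
  proof (intro card_image inj_onI)
    fix u v assume "L u = L v"
    moreover have "(u, 0) \<in> L u" using assms(2) by (simp add: L_def)
    ultimately show "u = v" by (simp add: L_def)
  qed
  have 4: "edges_between H (L u) (L v) = {}" if "u \<noteq> v" for u v
    using that by (auto simp: edges_between_def H_def L_def doubleton_eq_iff)
  have 5: "u \<noteq> v" if "{u, v} \<in> edges G" for u v
    using that assms(1) by (auto simp: simple_graph_def)
  have 6: "{x, y} \<in> edges H" if "u \<in> verts G" "x \<in> L u" "y \<in> L u" "x \<noteq> y" for u x y
    using that by (auto simp: H_def L_def)
  have "is_cover G L H"
    unfolding is_cover_def using 1 2 3 4 5 6 by auto
  moreover have "\<forall>u\<in>verts G. card (L u) = m" by (simp add: L_def)
  ultimately show ?thesis unfolding is_m_fold_cover_def by blast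
qed

lemma P_DP_attained:
  assumes "simple_graph G" "m \<ge> 1"
  shows "\<exists>L (H :: nat graph). is_m_fold_cover G m L H \<and> P_DP G m = card (cover_colorings G H)"
proof -
  have "\<exists>n L (H :: nat graph). is_m_fold_cover G m L H \<and> n = card (cover_colorings G H)"
    using m_fold_cover_exists[OF assms] m_fold_cover_transfer by blast
  then show ?thesis unfolding P_DP_def by (rule LeastI_ex)
qed

end

theory Submission
  imports Defs
begin

text \<open>
  Extend every matching of an \<open>m\<close>-fold cover of the wheel to a bijection and name the colors of
  the rim vertices after the hub colors they are matched to. The cover then is a sequence of
  permutations \<open>\<sigma> i\<close> of \<open>{..<m}\<close>, one per rim edge, and its colorings are the pairs of a hub color
  \<open>c\<close> and a cyclic sequence \<open>x\<close> avoiding \<open>c\<close> with \<open>x (i + 1) \<noteq> \<sigma> i (x i)\<close>.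

  Fix \<open>c\<close> and put \<open>q = m - 2\<close>. Counting walks shows that permutations of the remaining \<open>q + 1\<close>
  colors whose product around the cycle has \<open>f\<close> fixed points admit \<open>q^n + (-1)^n (f - 1)\<close> cyclic
  sequences. For odd \<open>n\<close> this is least when \<open>f = q + 1\<close>, i.e. for the trivial cover. For even \<open>n\<close>
  let \<open>s\<close> be the number of colors fixed by every \<open>\<sigma> i\<close>. A fixed \<open>c\<close> has \<open>f \<ge> s - 1\<close>. If \<open>c\<close> is moved
  by some \<open>\<sigma> i\<close>, removing it leaves a color unmatched along that edge, which contributes about
  \<open>B = (q^(n-1) + 1) / (q + 1)\<close> further sequences, and then \<open>f \<ge> s\<close>. Adding up, the total is at
  least \<open>m (q^n + q) + (m - s) (B - q - 1)\<close>, where \<open>B \<ge> q + 1\<close> if \<open>m \<ge> 4\<close>, and \<open>B = 1\<close> if \<open>m = 3\<close>.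
  In the latter case a 3-cycle on a single rim edge attains the bound with \<open>s = 0\<close>.
\<close>

subsection \<open>Walks and cyclic sequences avoiding permutations\<close>

text \<open>The relation depends on the position, so that each rim edge can carry its own
  permutation.\<close>

definition cyclic_seqs :: "nat \<Rightarrow> 'a set \<Rightarrow> (nat \<Rightarrow> 'a \<Rightarrow> 'a \<Rightarrow> bool) \<Rightarrow> (nat \<Rightarrow> 'a) set" where
  "cyclic_seqs n X R = {x \<in> {..<n} \<rightarrow>\<^sub>E X. \<forall>i<n. R i (x i) (x ((i + 1) mod n))}"

definition walks ::
  "nat \<Rightarrow> 'a set \<Rightarrow> (nat \<Rightarrow> 'a \<Rightarrow> 'a \<Rightarrow> bool) \<Rightarrow> 'a \<Rightarrow> 'a \<Rightarrow> (nat \<Rightarrow> 'a) set" where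
  "walks k X R a b =
     {x \<in> {..k} \<rightarrow>\<^sub>E X. x 0 = a \<and> x k = b \<and> (\<forall>i<k. R i (x i) (x (Suc i)))}"

lemma finite_cyclic_seqs: "finite X \<Longrightarrow> finite (cyclic_seqs n X R)"
  by (rule finite_subset[of _ "{..<n} \<rightarrow>\<^sub>E X"]) (auto simp: cyclic_seqs_def intro: finite_PiE)

lemma finite_walks: "finite X \<Longrightarrow> finite (walks k X R a b)"
  by (rule finite_subset[of _ "{..k} \<rightarrow>\<^sub>E X"]) (auto simp: walks_def intro: finite_PiE)

lemma cyclic_seqs_mono:
  assumes "\<And>i x y. i < n \<Longrightarrow> x \<in> X \<Longrightarrow> y \<in> X \<Longrightarrow> R i x y \<Longrightarrow> R' i x y"
  shows "cyclic_seqs n X R \<subseteq> cyclic_seqs n X R'"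
proof
  fix x assume x: "x \<in> cyclic_seqs n X R"
  then have mem: "x i \<in> X" if "i < n" for i
    using that by (auto simp: cyclic_seqs_def)
  have "R' i (x i) (x ((i + 1) mod n))" if "i < n" for i
    using x that mem by (intro assms) (auto simp: cyclic_seqs_def)
  then show "x \<in> cyclic_seqs n X R'"
    using x by (auto simp: cyclic_seqs_def)
qed

lemma cyclic_seqs_cong:
  assumes "\<And>i x y. i < n \<Longrightarrow> x \<in> X \<Longrightarrow> y \<in> X \<Longrightarrow> R i x y \<longleftrightarrow> R' i x y"
  shows "cyclic_seqs n X R = cyclic_seqs n X R'"
  using assms by (intro equalityI cyclic_seqs_mono) auto

text \<open>Reading a sequence from position \<open>r\<close> onward is injective and shifts the
  relations along.\<close>

lemma card_cyclic_seqs_le_rotate: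
  assumes "finite X"
  shows "card (cyclic_seqs n X R) \<le> card (cyclic_seqs n X (\<lambda>i. R ((i + r) mod n)))"
proof (cases "n = 0")
  case True
  then show ?thesis by (simp add: cyclic_seqs_def)
next
  case False
  define rot where "rot x = (\<lambda>i\<in>{..<n}. x ((i + r) mod n))" for x :: "nat \<Rightarrow> 'a"
  \<comment> \<open>Undoing the shift adds \<open>n - r mod n\<close> instead of subtracting
    \<open>r\<close>, as indices are natural numbers.\<close>
  have unrotate: "((j + (n - r mod n)) mod n + r) mod n = j" if "j < n" for j
  proof -
    have "((j + (n - r mod n)) mod n + r) mod n = (j + (n - r mod n) + r mod n) mod n"
      by (metis mod_add_left_eq mod_add_right_eq)
    also have "j + (n - r mod n) + r mod n = j + n"
      using False mod_less_divisor[of n r] by linarith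
    finally show ?thesis using that by simp
  qed
  show ?thesis
  proof (rule card_inj_on_le[of rot])
    show "inj_on rot (cyclic_seqs n X R)"
    proof (rule inj_onI)
      fix x y assume x: "x \<in> cyclic_seqs n X R" and y: "y \<in> cyclic_seqs n X R"
        and eq: "rot x = rot y"
      have "x j = y j" if "j < n" for j
        using fun_cong[OF eq, of "(j + (n - r mod n)) mod n"] unrotate[OF that] False
        by (simp add: rot_def)
      then show "x = y"
        using x y by (intro PiE_ext[of x "{..<n}" "\<lambda>_. X" y]) (auto simp: cyclic_seqs_def)
    qed
    show "rot ` cyclic_seqs n X R \<subseteq> cyclic_seqs n X (\<lambda>i. R ((i + r) mod n))"
    proof
      fix z assume "z \<in> rot ` cyclic_seqs n X R"
      then obtain x where x: "x \<in> cyclic_seqs n X R" and z: "z = rot x" by blast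
      have mem: "x i \<in> X" and step: "R i (x i) (x ((i + 1) mod n))" if "i < n" for i
        using that x by (auto simp: cyclic_seqs_def)
      have "R ((i + r) mod n) (rot x i) (rot x ((i + 1) mod n))" if "i < n" for i
      proof -
        have "((i + 1) mod n + r) mod n = ((i + r) mod n + 1) mod n"
          by (metis add.assoc add.commute mod_add_left_eq)
        then show ?thesis
          using that step[of "(i + r) mod n"] False by (simp add: rot_def)
      qed
      moreover have "rot x \<in> {..<n} \<rightarrow>\<^sub>E X"
        using mem False by (auto simp: rot_def)
      ultimately show "z \<in> cyclic_seqs n X (\<lambda>i. R ((i + r) mod n))"
        by (auto simp: cyclic_seqs_def z)
    qed
    show "finite (cyclic_seqs n X (\<lambda>i. R ((i + r) mod n)))"
      using assms by (rule finite_cyclic_seqs)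
  qed
qed

text \<open>Rotating on by \<open>n - r\<close> completes the turn, so the one-sided bound applies
  in both directions. This allows any chosen rim edge to be moved to the closing position.\<close>

lemma card_cyclic_seqs_rotate:
  assumes "finite X" "r \<le> n"
  shows "card (cyclic_seqs n X (\<lambda>i. R ((i + r) mod n))) = card (cyclic_seqs n X R)"
proof (rule antisym)
  have "card (cyclic_seqs n X (\<lambda>i. R ((i + r) mod n)))
      \<le> card (cyclic_seqs n X (\<lambda>i. R (((i + (n - r)) mod n + r) mod n)))"
    by (rule card_cyclic_seqs_le_rotate[OF assms(1), of n "\<lambda>i. R ((i + r) mod n)" "n - r"])
  also have "cyclic_seqs n X (\<lambda>i. R (((i + (n - r)) mod n + r) mod n)) = cyclic_seqs n X R"
    using assms(2) by (intro cyclic_seqs_cong) (simp add: mod_simps)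
  finally show "card (cyclic_seqs n X (\<lambda>i. R ((i + r) mod n))) \<le> card (cyclic_seqs n X R)" .
qed (rule card_cyclic_seqs_le_rotate[OF assms(1)])

section \<open>Counting walks and cyclic sequences\<close>

lemma card_walks_0:
  assumes "a \<in> X"
  shows "card (walks 0 X R a b) = (if b = a then 1 else 0)"
proof -
  have "walks 0 X R a b = (if b = a then {\<lambda>i\<in>{..0}. a} else {})"
    using assms by (auto simp: walks_def PiE_iff extensional_def restrict_def)
  then show ?thesis by simp
qed

lemma card_walks_Suc:
  assumes "finite X" "b \<in> X"
  shows "card (walks (Suc k) X R a b) = (\<Sum>c\<in>{c \<in> X. R k c b}. card (walks k X R a c))"
proof -
  let ?C = "{c \<in> X. R k c b}"
  have "bij_betw (\<lambda>x. restrict x {..k}) (walks (Suc k) X R a b) (\<Union>c\<in>?C. walks k X R a c)"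
  proof (rule bij_betw_byWitness[where f' = "\<lambda>x. x(Suc k := b)"])
    show "\<forall>x\<in>walks (Suc k) X R a b. (restrict x {..k})(Suc k := b) = x"
      by (auto simp: walks_def fun_eq_iff PiE_iff extensional_def restrict_def)
    show "\<forall>x\<in>\<Union>c\<in>?C. walks k X R a c. restrict (x(Suc k := b)) {..k} = x"
      by (auto simp: walks_def fun_eq_iff PiE_iff extensional_def restrict_def)
    show "(\<lambda>x. restrict x {..k}) ` walks (Suc k) X R a b \<subseteq> (\<Union>c\<in>?C. walks k X R a c)"
      by (auto simp: walks_def PiE_iff)
    show "(\<lambda>x. x(Suc k := b)) ` (\<Union>c\<in>?C. walks k X R a c) \<subseteq> walks (Suc k) X R a b"
      using assms(2) by (auto simp: walks_def PiE_iff extensional_def less_Suc_eq le_Suc_eq)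
  qed
  then have "card (walks (Suc k) X R a b) = card (\<Union>c\<in>?C. walks k X R a c)"
    by (rule bij_betw_same_card)
  also have "\<dots> = (\<Sum>c\<in>?C. card (walks k X R a c))"
  proof (rule card_UN_disjoint)
    show "\<forall>c\<in>?C. finite (walks k X R a c)" using assms(1) by (simp add: finite_walks)
    show "\<forall>c\<in>?C. \<forall>d\<in>?C. c \<noteq> d \<longrightarrow> walks k X R a c \<inter> walks k X R a d = {}"
      by (auto simp: walks_def)
  qed (use assms(1) in simp)
  finally show ?thesis .
qed

text \<open>Cutting the cycle at its last edge leaves a walk of length \<open>k\<close> from
  \<open>a\<close> to \<open>b\<close>, closed by the step of index \<open>k\<close> from
  \<open>b\<close> back to \<open>a\<close>.\<close>

lemma card_cyclic_seqs_Suc: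
  assumes "finite X"
  shows "card (cyclic_seqs (Suc k) X R) =
    (\<Sum>b\<in>X. \<Sum>a\<in>{a \<in> X. R k b a}. card (walks k X R a b))"
proof -
  let ?I = "SIGMA b:X. {a \<in> X. R k b a}"
  have step: "(\<forall>i<Suc k. R i (x i) (x ((i + 1) mod Suc k))) \<longleftrightarrow>
      (\<forall>i<k. R i (x i) (x (Suc i))) \<and> R k (x k) (x 0)" for x
    by (auto simp: All_less_Suc)
  have "cyclic_seqs (Suc k) X R = (\<Union>(b, a)\<in>?I. walks k X R a b)"
    unfolding cyclic_seqs_def step walks_def lessThan_Suc_atMost by (auto simp: PiE_iff)
  also have "card \<dots> = (\<Sum>(b, a)\<in>?I. card (walks k X R a b))"
    unfolding split_def
  proof (rule card_UN_disjoint)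
    show "finite ?I" using assms by simp
    show "\<forall>p\<in>?I. finite (walks k X R (snd p) (fst p))" using assms by (simp add: finite_walks)
    show "\<forall>p\<in>?I. \<forall>p'\<in>?I. p \<noteq> p' \<longrightarrow>
        walks k X R (snd p) (fst p) \<inter> walks k X R (snd p') (fst p') = {}"
      by (auto simp: walks_def)
  qed
  also have "\<dots> = (\<Sum>b\<in>X. \<Sum>a\<in>{a \<in> X. R k b a}. card (walks k X R a b))"
    using assms by (subst sum.Sigma) auto
  finally show ?thesis .
qed

text \<open>The number of walks of length \<open>k\<close> between distinct vertices of the complete graph on \<open>q + 1\<close>
  vertices.\<close>
fun walk_number :: "int \<Rightarrow> nat \<Rightarrow> int" where
  "walk_number q 0 = 0"
| "walk_number q (Suc k) = q ^ k - walk_number q k"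

lemma walk_number_closed_form: "(q + 1) * walk_number q k = q ^ k - (- 1) ^ k"
  by (induction k) (simp_all add: algebra_simps)

text \<open>The end of the walk from \<open>a\<close> that takes the forbidden step every
  time.\<close>

fun iter_perm :: "(nat \<Rightarrow> 'a \<Rightarrow> 'a) \<Rightarrow> nat \<Rightarrow> 'a \<Rightarrow> 'a" where
  "iter_perm \<tau> 0 a = a"
| "iter_perm \<tau> (Suc k) a = \<tau> k (iter_perm \<tau> k a)"

lemma iter_perm_fixed: "(\<And>i. i < k \<Longrightarrow> \<tau> i a = a) \<Longrightarrow> iter_perm \<tau> k a = a"
  by (induction k) auto

lemma iter_perm_mem: "(\<And>i. i < k \<Longrightarrow> \<tau> i ` X \<subseteq> X) \<Longrightarrow> a \<in> X \<Longrightarrow> iter_perm \<tau> k a \<in> X"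
  by (induction k) (auto simp: image_subset_iff)

text \<open>Renaming the colors along the permutations turns each forbidden step into staying put,
  so the walks are those of the complete graph on \<open>q + 1\<close> vertices; closed and open
  walks there differ in number by \<open>(- 1) ^ k\<close>. The relation is prescribed only below
  \<open>k\<close>, so a closing step may obey another rule.\<close>

lemma card_walks_avoiding:
  assumes X: "finite X" "int (card X) = q + 1"
    and \<tau>: "\<And>i. i < k \<Longrightarrow> bij_betw (\<tau> i) X X"
    and R: "\<And>i x y. i < k \<Longrightarrow> x \<in> X \<Longrightarrow> y \<in> X \<Longrightarrow> R i x y \<longleftrightarrow> y \<noteq> \<tau> i x"
    and "a \<in> X" "b \<in> X"
  shows "int (card (walks k X R a b)) =
    walk_number q k + (if b = iter_perm \<tau> k a then (- 1) ^ k else 0)"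
  using \<tau> R \<open>b \<in> X\<close>
proof (induction k arbitrary: b)
  case 0
  then show ?case using card_walks_0[OF \<open>a \<in> X\<close>, of R b] by simp
next
  case (Suc k)
  let ?W = "\<lambda>c. int (card (walks k X R a c))"
  have IH: "?W c = walk_number q k + (if c = iter_perm \<tau> k a then (- 1) ^ k else 0)"
    if "c \<in> X" for c
    using Suc.IH[of c] Suc.prems(1,2) that by simp
  have \<tau>k: "bij_betw (\<tau> k) X X" using Suc.prems(1) by simp
  have mem: "iter_perm \<tau> k a \<in> X"
    using Suc.prems(1) \<open>a \<in> X\<close> by (intro iter_perm_mem) (auto simp: bij_betw_def)
  obtain c where c: "c \<in> X" "b = \<tau> k c"
    using \<tau>k Suc.prems(3) by (auto simp: bij_betw_def)
  have "{d \<in> X. R k d b} = X - {c}"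
    using Suc.prems(2)[of k _ b] Suc.prems(3) c \<tau>k by (auto simp: bij_betw_def inj_on_eq_iff)
  then have "int (card (walks (Suc k) X R a b)) = (\<Sum>d\<in>X - {c}. ?W d)"
    using card_walks_Suc[OF X(1) Suc.prems(3), of k R a] by simp
  also have "\<dots> = (\<Sum>d\<in>X. ?W d) - ?W c"
    using X(1) c(1) by (simp add: sum_diff1)
  \<comment> \<open>Each of the \<open>k\<close> steps has \<open>q\<close> choices, so the walks
    from \<open>a\<close> to all ends together number \<open>q ^ k\<close>.\<close>
  also have "(\<Sum>d\<in>X. ?W d) = (q + 1) * walk_number q k + (- 1) ^ k"
    using X mem by (simp add: IH sum.distrib)
  also have "\<dots> = q ^ k"
    by (simp add: walk_number_closed_form)
  also have "q ^ k - ?W c =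
      walk_number q (Suc k) + (if b = iter_perm \<tau> (Suc k) a then (- 1) ^ Suc k else 0)"
    using IH[OF c(1)] c mem \<tau>k by (auto simp: bij_betw_def inj_on_eq_iff)
  finally show ?case .
qed

text \<open>The product around the whole cycle is read from position \<open>k\<close>, starting with
  the closing step, to fit the cut at the last edge.\<close>

definition closed_fixed_points :: "(nat \<Rightarrow> 'a \<Rightarrow> 'a) \<Rightarrow> nat \<Rightarrow> 'a set \<Rightarrow> 'a set" where
  "closed_fixed_points \<tau> k X = {b \<in> X. iter_perm \<tau> k (\<tau> k b) = b}"

text \<open>From all walks of length \<open>k\<close>, those whose ends are joined by the forbidden
  closing step are subtracted. Such a walk runs from \<open>\<tau> k b\<close> to \<open>b\<close>,
  and the correction \<open>(- 1) ^ k\<close> arises exactly when \<open>b\<close> is fixed by the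
  whole product.\<close>

lemma card_cyclic_seqs_avoiding:
  assumes X: "finite X" "int (card X) = q + 1"
    and \<tau>: "\<And>i. i < Suc k \<Longrightarrow> bij_betw (\<tau> i) X X"
  shows "int (card (cyclic_seqs (Suc k) X (\<lambda>i x y. y \<noteq> \<tau> i x))) =
    q ^ Suc k + (- 1) ^ Suc k * (int (card (closed_fixed_points \<tau> k X)) - 1)"
proof -
  let ?W = "\<lambda>a b. int (card (walks k X (\<lambda>i x y. y \<noteq> \<tau> i x) a b))"
  let ?e = "\<lambda>P. if P then (- 1) ^ k else (0::int)"
  have W: "?W a b = walk_number q k + ?e (b = iter_perm \<tau> k a)" if "a \<in> X" "b \<in> X" for a b
    using card_walks_avoiding[OF X, of k \<tau> _ a b] \<tau> that by simp
  have img: "\<tau> k b \<in> X" if "b \<in> X" for b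
    using \<tau>[of k] that by (auto simp: bij_betw_def)
  have mem: "iter_perm \<tau> k a \<in> X" if "a \<in> X" for a
    using \<tau> that by (intro iter_perm_mem) (auto simp: bij_betw_def)
  have "int (card (cyclic_seqs (Suc k) X (\<lambda>i x y. y \<noteq> \<tau> i x))) =
      (\<Sum>b\<in>X. \<Sum>a\<in>X - {\<tau> k b}. ?W a b)"
    unfolding card_cyclic_seqs_Suc[OF X(1)] by (simp add: set_diff_eq)
  also have "\<dots> = (\<Sum>b\<in>X. (\<Sum>a\<in>X. ?W a b) - ?W (\<tau> k b) b)"
    using X(1) img by (intro sum.cong) (simp_all add: sum_diff1)
  also have "\<dots> = (\<Sum>a\<in>X. \<Sum>b\<in>X. ?W a b) - (\<Sum>b\<in>X. ?W (\<tau> k b) b)"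
    unfolding sum_subtractf by (subst sum.swap) (rule refl)
  also have "(\<Sum>a\<in>X. \<Sum>b\<in>X. ?W a b) = (q + 1) * q ^ k"
  proof -
    have "(\<Sum>b\<in>X. ?W a b) = q ^ k" if "a \<in> X" for a
      using X mem[OF that] that by (simp add: W sum.distrib walk_number_closed_form)
    then show ?thesis using X(2) by simp
  qed
  also have "(\<Sum>b\<in>X. ?W (\<tau> k b) b) =
      (q + 1) * walk_number q k + (- 1) ^ k * int (card (closed_fixed_points \<tau> k X))"
  proof -
    have "(\<Sum>b\<in>X. ?e (b = iter_perm \<tau> k (\<tau> k b))) =
        (\<Sum>b\<in>closed_fixed_points \<tau> k X. (- 1) ^ k)"
      unfolding closed_fixed_points_def using X(1)
      by (subst sum.inter_filter) (auto intro!: sum.cong)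
    then show ?thesis using X(2) by (simp add: W img sum.distrib)
  qed
  finally show ?thesis unfolding walk_number_closed_form by (simp add: algebra_simps)
qed

text \<open>Lifting the closing constraint at \<open>b\<^sub>0\<close> adds exactly the walks from
  \<open>\<tau> k b\<^sub>0\<close> to \<open>b\<^sub>0\<close>. This models a color left unmatched
  when the hub color is deleted.\<close>

lemma card_cyclic_seqs_avoiding_except_one:
  assumes X: "finite X" "int (card X) = q + 1"
    and \<tau>: "\<And>i. i < Suc k \<Longrightarrow> bij_betw (\<tau> i) X X"
    and b\<^sub>0: "b\<^sub>0 \<in> X"
  shows "int (card (cyclic_seqs (Suc k) X (\<lambda>i x y. y \<noteq> \<tau> i x \<or> i = k \<and> x = b\<^sub>0))) =
    q ^ Suc k + (- 1) ^ Suc k * (int (card (closed_fixed_points \<tau> k X)) - 1)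
      + walk_number q k + (if b\<^sub>0 \<in> closed_fixed_points \<tau> k X then (- 1) ^ k else 0)"
proof -
  let ?R = "\<lambda>i x y. y \<noteq> \<tau> i x"
  let ?R' = "\<lambda>i x y. y \<noteq> \<tau> i x \<or> i = k \<and> x = b\<^sub>0"
  have img: "\<tau> k b\<^sub>0 \<in> X"
    using \<tau>[of k] b\<^sub>0 by (auto simp: bij_betw_def)
  \<comment> \<open>A walk of length \<open>k\<close> uses only relations of index below
    \<open>k\<close>, hence does not see the exception.\<close>
  have W: "walks k X ?R' = walks k X ?R"
    by (auto simp: walks_def fun_eq_iff)
  let ?W = "\<lambda>a b. card (walks k X ?R a b)"
  have "(\<Sum>a\<in>{a \<in> X. ?R' k b a}. ?W a b) =
      (\<Sum>a\<in>{a \<in> X. ?R k b a}. ?W a b) + (if b = b\<^sub>0 then ?W (\<tau> k b\<^sub>0) b\<^sub>0 else 0)" for b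
  proof (cases "b = b\<^sub>0")
    case True
    have "{a \<in> X. ?R' k b a} = insert (\<tau> k b\<^sub>0) {a \<in> X. ?R k b a}"
      using True img by auto
    then have "(\<Sum>a\<in>{a \<in> X. ?R' k b a}. ?W a b) =
        (\<Sum>a\<in>insert (\<tau> k b\<^sub>0) {a \<in> X. ?R k b a}. ?W a b)"
      by (rule arg_cong)
    then show ?thesis using True X(1) by simp
  qed simp
  then have "card (cyclic_seqs (Suc k) X ?R') =
      card (cyclic_seqs (Suc k) X ?R) + ?W (\<tau> k b\<^sub>0) b\<^sub>0"
    unfolding card_cyclic_seqs_Suc[OF X(1)] W using X(1) b\<^sub>0 by (simp add: sum.distrib)
  moreover have "int (?W (\<tau> k b\<^sub>0) b\<^sub>0) =
      walk_number q k + (if b\<^sub>0 \<in> closed_fixed_points \<tau> k X then (- 1) ^ k else 0)"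
    using card_walks_avoiding[OF X, of k \<tau> _ "\<tau> k b\<^sub>0" b\<^sub>0] \<tau> img b\<^sub>0
    by (auto simp: closed_fixed_points_def)
  ultimately show ?thesis
    using card_cyclic_seqs_avoiding[OF X \<tau>] by simp
qed

subsection \<open>Colorings of the wheel twisted by permutations\<close>

text \<open>Deletes \<open>c\<close> from its cycle in a permutation \<open>f\<close>. On arguments other than \<open>c\<close> the result agrees
  with \<open>f\<close> wherever \<open>f\<close> does not take the value \<open>c\<close>, so avoiding it is a stronger constraint than
  avoiding \<open>f\<close>.\<close>
definition bypass :: "('a \<Rightarrow> 'a) \<Rightarrow> 'a \<Rightarrow> 'a \<Rightarrow> 'a" where
  "bypass f c x = (if f x = c then f c else f x)"

lemma bij_betw_bypass:
  assumes "finite A" "bij_betw f A A" "c \<in> A"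
  shows "bij_betw (bypass f c) (A - {c}) (A - {c})"
proof -
  have f: "inj_on f A" "f ` A = A" using assms(2) by (auto simp: bij_betw_def)
  have "inj_on (bypass f c) (A - {c})"
    using f(1) assms(3) by (auto simp: inj_on_def bypass_def split: if_splits)
  moreover have "bypass f c ` (A - {c}) \<subseteq> A - {c}"
    using f assms(3) by (auto simp: bypass_def inj_on_def)
  ultimately show ?thesis
    using assms(1) by (simp add: bij_betw_def endo_inj_surj)
qed

definition twisted_colorings :: "nat \<Rightarrow> nat \<Rightarrow> (nat \<Rightarrow> nat \<Rightarrow> nat) \<Rightarrow> (nat \<times> (nat \<Rightarrow> nat)) set" where
  "twisted_colorings n m \<sigma> =
     (SIGMA c:{..<m}. cyclic_seqs n ({..<m} - {c}) (\<lambda>i x y. y \<noteq> \<sigma> i x))"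

lemma finite_twisted_colorings: "finite (twisted_colorings n m \<sigma>)"
  unfolding twisted_colorings_def by (intro finite_SigmaI finite_cyclic_seqs) auto

lemma card_twisted_colorings:
  "card (twisted_colorings n m \<sigma>) =
     (\<Sum>c<m. card (cyclic_seqs n ({..<m} - {c}) (\<lambda>i x y. y \<noteq> \<sigma> i x)))"
  unfolding twisted_colorings_def by (rule card_SigmaI) (auto intro: finite_cyclic_seqs)

text \<open>The identity permutations encode the trivial cover: each hub color contributes the
  chromatic polynomial of the \<open>n\<close>-cycle at \<open>m - 1\<close>.\<close>

lemma card_twisted_colorings_id:
  assumes "n \<ge> 1"
  shows "int (card (twisted_colorings n m (\<lambda>_ x. x))) =
    int m * ((int m - 2) ^ n + (- 1) ^ n * (int m - 2))"
proof -
  obtain k where k: "n = Suc k" using assms by (cases n) auto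
  have "int (card (cyclic_seqs n ({..<m} - {c}) (\<lambda>i x y. y \<noteq> x))) =
      (int m - 2) ^ n + (- 1) ^ n * (int m - 2)" if "c < m" for c
  proof -
    let ?X = "{..<m} - {c}"
    have X: "int (card ?X) = (int m - 2) + 1" using that by (simp add: of_nat_diff)
    have "closed_fixed_points (\<lambda>_ x. x) k ?X = ?X"
      by (auto simp: closed_fixed_points_def iter_perm_fixed)
    then show ?thesis
      using card_cyclic_seqs_avoiding[OF _ X, of k "\<lambda>_ x. x"] X
      by (simp add: k bij_betw_def)
  qed
  then show ?thesis by (simp add: card_twisted_colorings)
qed

section \<open>Lower bounds for arbitrary permutations\<close>

context
  fixes n m :: nat and \<sigma> :: "nat \<Rightarrow> nat \<Rightarrow> nat"
  assumes \<sigma>: "\<And>i. i < n \<Longrightarrow> bij_betw (\<sigma> i) {..<m} {..<m}"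
begin

private lemma bij_bypass:
  assumes "c < m" "i < n"
  shows "bij_betw (bypass (\<sigma> i) c) ({..<m} - {c}) ({..<m} - {c})"
  using assms \<sigma> by (intro bij_betw_bypass) auto

private lemma card_remove: "c < m \<Longrightarrow> int (card ({..<m} - {c})) = (int m - 2) + 1"
  by (simp add: of_nat_diff)

text \<open>For odd \<open>n\<close> fixed points of the product lower the count, so the worst case
  is that all \<open>m - 1\<close> remaining colors are fixed.\<close>

private lemma card_cyclic_seqs_ge_odd:
  assumes "odd n" "c < m"
  shows "int (card (cyclic_seqs n ({..<m} - {c}) (\<lambda>i x y. y \<noteq> \<sigma> i x)))
    \<ge> (int m - 2) ^ n - (int m - 2)"
proof -
  let ?X = "{..<m} - {c}"
  let ?\<tau> = "\<lambda>i. bypass (\<sigma> i) c"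
  obtain k where k: "n = Suc k" using assms(1) by (cases n) auto
  have "card (closed_fixed_points ?\<tau> k ?X) \<le> card ?X"
    by (rule card_mono) (auto simp: closed_fixed_points_def)
  then have "(int m - 2) ^ n - (int m - 2) \<le>
      (int m - 2) ^ n + (- 1) ^ n * (int (card (closed_fixed_points ?\<tau> k ?X)) - 1)"
    using assms(1) card_remove[OF assms(2)] by simp
  also have "\<dots> = int (card (cyclic_seqs n ?X (\<lambda>i x y. y \<noteq> ?\<tau> i x)))"
    unfolding k using bij_bypass[OF assms(2)] k
    by (intro card_cyclic_seqs_avoiding[symmetric] card_remove assms(2)) auto
  \<comment> \<open>Colors other than \<open>c\<close> that avoid the bypassed permutation also
    avoid \<open>\<sigma> i\<close>, since a value \<open>c\<close> of \<open>\<sigma> i\<close>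
    excludes none of them.\<close>
  also have "\<dots> \<le> int (card (cyclic_seqs n ?X (\<lambda>i x y. y \<noteq> \<sigma> i x)))"
    by (intro of_nat_mono card_mono finite_cyclic_seqs cyclic_seqs_mono) (auto simp: bypass_def)
  finally show ?thesis .
qed

lemma card_twisted_colorings_ge_odd:
  assumes "odd n"
  shows "int (card (twisted_colorings n m \<sigma>)) \<ge> int m * ((int m - 2) ^ n - (int m - 2))"
proof -
  have "int m * ((int m - 2) ^ n - (int m - 2)) = (\<Sum>c<m. (int m - 2) ^ n - (int m - 2))"
    by simp
  also have "\<dots> \<le> (\<Sum>c<m. int (card (cyclic_seqs n ({..<m} - {c}) (\<lambda>i x y. y \<noteq> \<sigma> i x))))"
    by (intro sum_mono card_cyclic_seqs_ge_odd assms) simp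
  finally show ?thesis by (simp add: card_twisted_colorings)
qed

text \<open>Fixed edge by edge and not merely by the product: such a color stays fixed after any
  other color is bypassed.\<close>

private definition "common_fixed = {c. c < m \<and> (\<forall>i<n. \<sigma> i c = c)}"

private lemma finite_common_fixed: "finite common_fixed"
  by (simp add: common_fixed_def)

text \<open>Every common fixed color other than \<open>c\<close> stays fixed by the bypassed
  product, and for even \<open>n\<close> fixed points raise the count.\<close>

private lemma card_cyclic_seqs_ge_fixed:
  assumes "even n" "n \<ge> 1" "c \<in> common_fixed"
  shows "int (card (cyclic_seqs n ({..<m} - {c}) (\<lambda>i x y. y \<noteq> \<sigma> i x)))
    \<ge> (int m - 2) ^ n + int (card common_fixed) - 2"
proof -
  let ?X = "{..<m} - {c}"
  let ?\<tau> = "\<lambda>i. bypass (\<sigma> i) c"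
  have c: "c < m" using assms(3) by (simp add: common_fixed_def)
  obtain k where k: "n = Suc k" using assms(2) by (cases n) auto
  have "common_fixed - {c} \<subseteq> closed_fixed_points ?\<tau> k ?X"
  proof
    fix a assume a: "a \<in> common_fixed - {c}"
    then have "a < m" "a \<noteq> c" by (auto simp: common_fixed_def)
    moreover from a have "?\<tau> i a = a" if "i < n" for i
      using that by (simp add: common_fixed_def bypass_def)
    ultimately show "a \<in> closed_fixed_points ?\<tau> k ?X"
      using k by (simp add: closed_fixed_points_def iter_perm_fixed)
  qed
  then have "card (common_fixed - {c}) \<le> card (closed_fixed_points ?\<tau> k ?X)"
    by (rule card_mono[rotated]) (simp add: closed_fixed_points_def)
  moreover have "card common_fixed = Suc (card (common_fixed - {c}))"
    using assms(3) finite_common_fixed by (rule card.remove[rotated])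
  ultimately have "(int m - 2) ^ n + int (card common_fixed) - 2 \<le>
      (int m - 2) ^ n + (- 1) ^ n * (int (card (closed_fixed_points ?\<tau> k ?X)) - 1)"
    using assms(1) by simp
  also have "\<dots> = int (card (cyclic_seqs n ?X (\<lambda>i x y. y \<noteq> ?\<tau> i x)))"
    unfolding k using bij_bypass[OF c] k
    by (intro card_cyclic_seqs_avoiding[symmetric] card_remove c) auto
  also have "\<dots> \<le> int (card (cyclic_seqs n ?X (\<lambda>i x y. y \<noteq> \<sigma> i x)))"
    by (intro of_nat_mono card_mono finite_cyclic_seqs cyclic_seqs_mono) (auto simp: bypass_def)
  finally show ?thesis .
qed

text \<open>Along an edge that moves \<open>c\<close>, the preimage \<open>b\<close> of
  \<open>c\<close> forbids nothing, as \<open>c\<close> is absent from the rim. Granting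
  \<open>b\<close> this freedom in the bypassed problem yields the extra walks.\<close>

private lemma card_cyclic_seqs_ge_moved:
  assumes "even n" "c < m" "c \<notin> common_fixed"
  shows "int (card (cyclic_seqs n ({..<m} - {c}) (\<lambda>i x y. y \<noteq> \<sigma> i x)))
    \<ge> (int m - 2) ^ n + int (card common_fixed) - 1 + walk_number (int m - 2) (n - 1)"
proof -
  let ?X = "{..<m} - {c}"
  obtain j where j: "j < n" "\<sigma> j c \<noteq> c"
    using assms(2,3) by (auto simp: common_fixed_def)
  obtain k where k: "n = Suc k" using j(1) by (cases n) auto
  \<comment> \<open>Rotation by \<open>Suc j\<close> makes the edge that moves \<open>c\<close> the
    closing one.\<close>
  define \<sigma>' where "\<sigma>' i = \<sigma> ((i + Suc j) mod n)" for i
  define \<tau> where "\<tau> i = bypass (\<sigma>' i) c" for i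
  have \<sigma>'k: "\<sigma>' k = \<sigma> j" using j(1) mod_add_self1[of n j] by (simp add: \<sigma>'_def k)
  have "\<sigma> j ` {..<m} = {..<m}" using \<sigma>[OF j(1)] by (simp add: bij_betw_def)
  then obtain b where b: "b < m" "\<sigma> j b = c" using assms(2) by (metis imageE lessThan_iff)
  have "b \<noteq> c" using b j by auto
  have fixed: "a < m" "a \<noteq> c" "\<tau> i a = a" if "a \<in> common_fixed" for a i
    using that assms(3) j(1) by (auto simp: common_fixed_def \<tau>_def \<sigma>'_def bypass_def)
  have "b \<notin> common_fixed" using b j \<open>b \<noteq> c\<close> by (auto simp: common_fixed_def)
  let ?F = "closed_fixed_points \<tau> k ?X"
  have fin: "finite ?F" by (simp add: closed_fixed_points_def)
  have sub: "common_fixed \<subseteq> ?F"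
    using fixed by (auto simp: closed_fixed_points_def iter_perm_fixed)
  \<comment> \<open>If \<open>b\<close> is itself fixed by the product, the odd walk length costs
    one extra walk, but \<open>b\<close> then is a fixed point beyond the common ones, which makes
    up for it.\<close>
  have "int (card common_fixed) \<le> int (card ?F) - (if b \<in> ?F then 1 else 0)"
  proof (cases "b \<in> ?F")
    case True
    then have "card (insert b common_fixed) \<le> card ?F"
      using sub fin by (intro card_mono) auto
    then show ?thesis
      using True \<open>b \<notin> common_fixed\<close> finite_common_fixed by simp
  next
    case False
    then show ?thesis using card_mono[OF fin sub] by simp
  qed
  moreover have "odd k" using assms(1) k by simp
  ultimately have "(int m - 2) ^ n + int (card common_fixed) - 1 + walk_number (int m - 2) (n - 1)
      \<le> (int m - 2) ^ n + (- 1) ^ n * (int (card ?F) - 1) + walk_number (int m - 2) k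
          + (if b \<in> ?F then (- 1) ^ k else 0)"
    using k assms(1) by (auto split: if_splits)
  also have "\<dots> = int (card (cyclic_seqs n ?X (\<lambda>i x y. y \<noteq> \<tau> i x \<or> i = k \<and> x = b)))"
    unfolding k
  proof (intro card_cyclic_seqs_avoiding_except_one[symmetric] card_remove assms(2))
    show "bij_betw (\<tau> i) ?X ?X" for i
      unfolding \<tau>_def \<sigma>'_def using j(1) by (intro bij_bypass assms(2)) simp
  qed (use b(1) \<open>b \<noteq> c\<close> in auto)
  also have "\<dots> \<le> int (card (cyclic_seqs n ?X (\<lambda>i x y. y \<noteq> \<sigma>' i x)))"
    using b(2) by (intro of_nat_mono card_mono finite_cyclic_seqs cyclic_seqs_mono)
      (auto simp: \<tau>_def bypass_def \<sigma>'k)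
  also have "card (cyclic_seqs n ?X (\<lambda>i x y. y \<noteq> \<sigma>' i x)) =
      card (cyclic_seqs n ?X (\<lambda>i x y. y \<noteq> \<sigma> i x))"
    unfolding \<sigma>'_def using j(1)
    by (intro card_cyclic_seqs_rotate[where R = "\<lambda>i x y. y \<noteq> \<sigma> i x"]) auto
  finally show ?thesis .
qed

text \<open>The witness \<open>d\<close> is the number of colors moved by some permutation. A moved
  hub color gains walks, while every moved color may cost fixed points for the other hub
  colors.\<close>

lemma card_twisted_colorings_ge_even:
  assumes "even n" "n \<ge> 1"
  shows "\<exists>d\<le>m. int (card (twisted_colorings n m \<sigma>)) \<ge>
    int m * ((int m - 2) ^ n + (int m - 2))
      + int d * (walk_number (int m - 2) (n - 1) - (int m - 1))"
proof -
  define q where "q = int m - 2"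
  define B where "B = walk_number q (n - 1)"
  let ?S = common_fixed
  let ?N = "\<lambda>c. int (card (cyclic_seqs n ({..<m} - {c}) (\<lambda>i x y. y \<noteq> \<sigma> i x)))"
  have S: "?S \<subseteq> {..<m}" by (auto simp: common_fixed_def)
  then have s: "card ?S \<le> m" using card_mono[OF _ S] by simp
  define d where "d = m - card ?S"
  have cS: "int (card ?S) = q + 2 - int d" using s by (simp add: d_def q_def)
  have cT: "card ({..<m} - ?S) = d"
    using S finite_common_fixed by (simp add: card_Diff_subset d_def)
  \<comment> \<open>Each moved color costs one fixed point for each of the other
    \<open>m - 1 = q + 1\<close> hub colors, so the terms quadratic in \<open>d\<close>
    cancel.\<close>
  have "int m * (q ^ n + q) + int d * (B - (q + 1)) =
      (q + 2 - int d) * (q ^ n + (q + 2 - int d) - 2) + int d * (q ^ n + (q + 2 - int d) - 1 + B)"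
    by (simp add: q_def algebra_simps)
  also have "\<dots> = (\<Sum>c\<in>?S. q ^ n + int (card ?S) - 2)
      + (\<Sum>c\<in>{..<m} - ?S. q ^ n + int (card ?S) - 1 + B)"
    by (simp add: cT cS)
  also have "\<dots> \<le> (\<Sum>c\<in>?S. ?N c) + (\<Sum>c\<in>{..<m} - ?S. ?N c)"
    unfolding q_def B_def using assms
    by (intro add_mono sum_mono card_cyclic_seqs_ge_fixed card_cyclic_seqs_ge_moved) auto
  also have "\<dots> = (\<Sum>c<m. ?N c)"
    using S by (simp add: sum.subset_diff[of ?S "{..<m}"])
  finally show ?thesis
    by (intro exI[of _ d]) (simp add: card_twisted_colorings q_def B_def d_def)
qed

end

section \<open>The gain term, and the extremal case of three colors\<close>

lemma walk_number_odd_ge: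
  assumes "q \<ge> 2" "odd k" "k \<ge> 3"
  shows "walk_number q k \<ge> q + 1"
proof -
  have "(q + 1) * (q + 1) \<le> q ^ 3 + 1"
  proof -
    \<comment> \<open>The case \<open>k = 3\<close> decides: after division by \<open>q + 1\<close>
      it reads \<open>q^2 - q + 1 \<ge> q + 1\<close>, which for positive \<open>q\<close> begins at
      \<open>q = 2\<close>, that is \<open>m = 4\<close>.\<close>
    have "q ^ 3 + 1 - (q + 1) * (q + 1) = q * (q + 1) * (q - 2)"
      by (simp add: power3_eq_cube algebra_simps)
    moreover have "q * (q + 1) * (q - 2) \<ge> 0" using assms(1) by simp
    ultimately show ?thesis by linarith
  qed
  also have "\<dots> \<le> q ^ k + 1"
    using assms by (simp add: power_increasing)
  also have "\<dots> = (q + 1) * walk_number q k"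
    using assms(2) by (simp add: walk_number_closed_form)
  finally show ?thesis using assms(1) by simp
qed

lemma walk_number_1_odd: "odd k \<Longrightarrow> walk_number 1 k = 1"
  using walk_number_closed_form[of 1 k] by simp

text \<open>For each hub color two colors remain, alternating along the edges with identity
  permutations; the closing 3-cycle rejects one of the two alternations.\<close>

lemma card_twisted_colorings_3:
  assumes "even n" "n \<ge> 1"
  shows "card (twisted_colorings n 3 (\<lambda>i x. if i = n - 1 then (x + 1) mod 3 else x)) = 3"
proof -
  let ?\<sigma> = "\<lambda>i x. if i = n - 1 then (x + 1) mod 3 else (x::nat)"
  obtain k where k: "n = Suc k" using assms(2) by (cases n) auto
  then have "odd k" using assms(1) by simp
  have "card (cyclic_seqs n ({..<3} - {c}) (\<lambda>i x y. y \<noteq> ?\<sigma> i x)) = 1" if "c < 3" for c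
  proof -
    let ?X = "{..<3} - {c}"
    let ?R = "\<lambda>i x y. y \<noteq> ?\<sigma> i x"
    \<comment> \<open>On two colors with an odd number of steps, a walk must end at the color it did
      not start with.\<close>
    have "card (walks k ?X ?R a b) = (if b = a then 0 else 1)" if "a \<in> ?X" "b \<in> ?X" for a b
    proof -
      have "int (card (walks k ?X ?R a b)) =
          walk_number 1 k + (if b = iter_perm (\<lambda>_ x. x) k a then (- 1) ^ k else 0)"
        using that \<open>c < 3\<close> k by (intro card_walks_avoiding) (auto simp: bij_betw_def)
      then show ?thesis
        using \<open>odd k\<close> by (auto simp: walk_number_1_odd iter_perm_fixed split: if_splits)
    qed
    then have "card (cyclic_seqs n ?X ?R) =
        (\<Sum>b\<in>?X. \<Sum>a\<in>{a \<in> ?X. a \<noteq> (b + 1) mod 3}. if b = a then 0 else 1)"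
      by (simp add: k card_cyclic_seqs_Suc)
    also have "\<dots> = (\<Sum>b\<in>?X. \<Sum>a\<in>?X. if a = (b + 1) mod 3 \<or> b = a then 0 else 1)"
      by (intro sum.cong refl sum.mono_neutral_cong_left) auto
    also have "\<dots> = 1"
    proof -
      \<comment> \<open>In each pair of colors exactly one ordered choice has \<open>a\<close> equal
        to \<open>b - 1\<close> modulo 3.\<close>
      have "?X = {1, 2} \<or> ?X = {0, 2} \<or> ?X = {0, 1}" using \<open>c < 3\<close> by auto
      then show ?thesis by (elim disjE) (simp_all only:, simp_all)
    qed
    finally show ?thesis .
  qed
  then show ?thesis by (simp add: card_twisted_colorings)
qed

subsection \<open>Covers, transversals and conflict graphs\<close>

text \<open>Cover colorings as functions. Testing only pairs adjacent in \<open>G\<close> is enough,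
  because in a cover the lists of distinct nonadjacent vertices have no edges between them.\<close>

definition transversals :: "'v graph \<Rightarrow> ('v \<Rightarrow> 'w set) \<Rightarrow> 'w graph \<Rightarrow> ('v \<Rightarrow> 'w) set" where
  "transversals G L H =
     {f \<in> Pi\<^sub>E (verts G) L. \<forall>u\<in>verts G. \<forall>v\<in>verts G. {u, v} \<in> edges G \<longrightarrow> {f u, f v} \<notin> edges H}"

text \<open>The partition concerns the set of lists; the cardinality clause makes \<open>L\<close>
  injective, so that a shared element determines the vertex.\<close>

lemma cover_lists_disjoint:
  assumes "is_cover G L H" "finite (verts G)" "u \<in> verts G" "v \<in> verts G" "x \<in> L u" "x \<in> L v"
  shows "u = v"
proof -
  have "inj_on L (verts G)"
    using assms(1,2) by (auto simp: is_cover_def intro: eq_card_imp_inj_on)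
  moreover have "disjoint (L ` verts G)"
    using assms(1) by (simp add: is_cover_def partition_on_def)
  then have "L u = L v"
    using assms(3-) by (auto dest: disjointD)
  ultimately show ?thesis
    using assms(3,4) by (simp add: inj_on_eq_iff)
qed

text \<open>Disjoint lists make a transversal recoverable from its image; this carries lower bounds
  over to covers.\<close>

lemma card_transversals_le:
  assumes cov: "is_cover G L H" and fin: "finite (verts G)"
  shows "card (transversals G L H) \<le> card (cover_colorings G H)"
proof (rule card_inj_on_le[of "\<lambda>f. f ` verts G"])
  note disj = cover_lists_disjoint[OF cov fin]
  have H: "finite (verts H)" "\<And>e. e \<in> edges H \<Longrightarrow> card e = 2"
    and L: "\<And>u. u \<in> verts G \<Longrightarrow> L u \<subseteq> verts H"
    and cross: "\<And>u v. u \<in> verts G \<Longrightarrow> v \<in> verts G \<Longrightarrow> u \<noteq> v \<Longrightarrow>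
      edges_between H (L u) (L v) \<noteq> {} \<Longrightarrow> {u, v} \<in> edges G"
    using cov by (auto simp: is_cover_def simple_graph_def partition_on_def)
  show "inj_on (\<lambda>f. f ` verts G) (transversals G L H)"
  proof (rule inj_onI)
    fix f g assume f: "f \<in> transversals G L H" and g: "g \<in> transversals G L H"
      and eq: "f ` verts G = g ` verts G"
    have "f u = g u" if u: "u \<in> verts G" for u
    proof -
      obtain v where v: "v \<in> verts G" "f u = g v" using eq u by blast
      moreover have "f u \<in> L u" "g v \<in> L v"
        using f g u v(1) by (auto simp: transversals_def)
      ultimately show ?thesis using disj[OF u v(1), of "f u"] by simp
    qed
    then show "f = g"
      using f g by (intro PiE_ext[of f "verts G" L g]) (auto simp: transversals_def)
  qed
  show "(\<lambda>f. f ` verts G) ` transversals G L H \<subseteq> cover_colorings G H"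
  proof
    fix I assume "I \<in> (\<lambda>f. f ` verts G) ` transversals G L H"
    then obtain f where f: "f \<in> transversals G L H" and I: "I = f ` verts G" by blast
    have mem: "f u \<in> L u" if "u \<in> verts G" for u
      using f that by (auto simp: transversals_def)
    have "inj_on f (verts G)"
      using disj mem by (metis inj_onI)
    then have "card I = card (verts G)" unfolding I by (rule card_image)
    moreover have "{f u, f v} \<notin> edges H" if uv: "u \<in> verts G" "v \<in> verts G" for u v
    proof
      assume e: "{f u, f v} \<in> edges H"
      then have "u \<noteq> v" using H(2)[OF e] by auto
      moreover have "edges_between H (L u) (L v) \<noteq> {}"
        using e mem uv by (auto simp: edges_between_def)
      ultimately have "{u, v} \<in> edges G" using cross uv by blast
      then show False using f e uv by (auto simp: transversals_def)
    qed
    moreover have "I \<subseteq> verts H" unfolding I using mem L by blast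
    ultimately show "I \<in> cover_colorings G H"
      by (auto simp: cover_colorings_def independent_set_def I)
  qed
  have "cover_colorings G H \<subseteq> Pow (verts H)"
    by (auto simp: cover_colorings_def independent_set_def)
  then show "finite (cover_colorings G H)"
    using H(1) by (meson finite_Pow_iff finite_subset)
qed

text \<open>On the matched vertices the matching itself is a bijection, and the unmatched vertices
  on the two sides are equally many, so any bijection between them completes it.\<close>

lemma bij_betw_extend_matching:
  assumes fin: "finite A" "finite B" and card: "card A = card B"
    and M: "M \<subseteq> A \<times> B"
    and left: "\<And>x y y'. (x, y) \<in> M \<Longrightarrow> (x, y') \<in> M \<Longrightarrow> y = y'"
    and right: "\<And>x x' y. (x, y) \<in> M \<Longrightarrow> (x', y) \<in> M \<Longrightarrow> x = x'"
  obtains \<beta> where "bij_betw \<beta> A B" "\<And>x y. (x, y) \<in> M \<Longrightarrow> \<beta> x = y"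
proof -
  have "finite M" using M fin by (meson finite_SigmaI finite_subset)
  have injs: "inj_on fst M" "inj_on snd M"
    using left right by (auto simp: inj_on_def)
  have subs: "fst ` M \<subseteq> A" "snd ` M \<subseteq> B" using M by auto
  define g where "g x = (THE y. (x, y) \<in> M)" for x
  have g: "g x = y" if "(x, y) \<in> M" for x y
    unfolding g_def using left that by blast
  have "bij_betw g (fst ` M) (snd ` M)"
  proof (rule bij_betwI')
    show "g x \<in> snd ` M" if "x \<in> fst ` M" for x using that g by force
    show "\<exists>x\<in>fst ` M. y = g x" if "y \<in> snd ` M" for y using that g by force
    show "(g x = g x') = (x = x')" if "x \<in> fst ` M" "x' \<in> fst ` M" for x x'
      using that g right by fastforce
  qed
  moreover have "card (A - fst ` M) = card (B - snd ` M)"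
    using subs fin card injs \<open>finite M\<close> by (simp add: card_Diff_subset card_image)
  then obtain h where "bij_betw h (A - fst ` M) (B - snd ` M)"
    using fin by (metis finite_Diff finite_same_card_bij)
  ultimately have "bij_betw (\<lambda>x. if x \<in> fst ` M then g x else h x)
      (fst ` M \<union> (A - fst ` M)) (snd ` M \<union> (B - snd ` M))"
    by (intro bij_betw_disjoint_Un) auto
  then have "bij_betw (\<lambda>x. if x \<in> fst ` M then g x else h x) A B"
    using subs by (simp add: Un_absorb1)
  then show thesis using g by (intro that) force+
qed

text \<open>Every edge between the lists is respected, while the bijection may forbid further pairs;
  lower bounds proved for the bijection therefore hold for the cover.\<close>

lemma m_fold_cover_edge_bij:
  assumes cov: "is_m_fold_cover G m L H" and fin: "finite (verts G)"
    and uv: "u \<in> verts G" "v \<in> verts G" "{u, v} \<in> edges G" "u \<noteq> v"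
  shows "\<exists>\<beta>. bij_betw \<beta> (L u) (L v) \<and>
    (\<forall>x\<in>L u. \<forall>y\<in>L v. {x, y} \<in> edges H \<longrightarrow> \<beta> x = y)"
proof -
  let ?M = "{(x, y). x \<in> L u \<and> y \<in> L v \<and> {x, y} \<in> edges H}"
  have cov': "is_cover G L H" using cov by (simp add: is_m_fold_cover_def)
  have matching: "disjoint (edges_between H (L u) (L v))"
    using cov' uv by (simp add: is_cover_def)
  have "finite (verts H)" "L u \<subseteq> verts H" "L v \<subseteq> verts H"
    using cov' uv by (auto simp: is_cover_def simple_graph_def partition_on_def)
  then have "finite (L u)" "finite (L v)" by (auto intro: finite_subset)
  have sep: "x \<noteq> y" if "x \<in> L u" "y \<in> L v" for x y
    using cover_lists_disjoint[OF cov' fin uv(1,2)] that uv(4) by blast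
  have meet: "{x, y} = {x', y'}"
    if "(x, y) \<in> ?M" "(x', y') \<in> ?M" "x = x' \<or> y = y'" for x y x' y'
  proof -
    have "{x, y} \<in> edges_between H (L u) (L v)" "{x', y'} \<in> edges_between H (L u) (L v)"
      using that by (auto simp: edges_between_def)
    moreover have "{x, y} \<inter> {x', y'} \<noteq> {}" using that(3) by auto
    ultimately show ?thesis using matching by (meson disjointD)
  qed
  show ?thesis
  proof (rule bij_betw_extend_matching[of "L u" "L v" ?M])
    show "finite (L u)" "finite (L v)" by fact+
    show "card (L u) = card (L v)" using cov uv by (simp add: is_m_fold_cover_def)
    show "?M \<subseteq> L u \<times> L v" by auto
    show "y = y'" if "(x, y) \<in> ?M" "(x, y') \<in> ?M" for x y y'
      using meet[OF that] by (auto simp: doubleton_eq_iff)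
    show "x = x'" if "(x, y) \<in> ?M" "(x', y) \<in> ?M" for x x' y
      using meet[OF that] by (auto simp: doubleton_eq_iff)
    show ?thesis if "bij_betw \<beta> (L u) (L v)" "\<And>x y. (x, y) \<in> ?M \<Longrightarrow> \<beta> x = y" for \<beta>
      using that by (intro exI[of _ \<beta>]) auto
  qed
qed

section \<open>Covers built from conflict relations\<close>

definition conflict_graph ::
  "'v graph \<Rightarrow> nat \<Rightarrow> ('v \<Rightarrow> nat \<Rightarrow> 'v \<Rightarrow> nat \<Rightarrow> bool) \<Rightarrow> ('v \<times> nat) graph" where
  "conflict_graph G m Q =
     \<lparr>verts = verts G \<times> {..<m},
      edges = {{(u, a), (v, b)} | u a v b. u \<in> verts G \<and> v \<in> verts G \<and> a < m \<and> b < m \<and>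
        (u = v \<and> a \<noteq> b \<or> {u, v} \<in> edges G \<and> Q u a v b)}\<rparr>"

definition conflict_colorings ::
  "'v graph \<Rightarrow> nat \<Rightarrow> ('v \<Rightarrow> nat \<Rightarrow> 'v \<Rightarrow> nat \<Rightarrow> bool) \<Rightarrow> ('v \<Rightarrow> nat) set" where
  "conflict_colorings G m Q =
     {f \<in> verts G \<rightarrow>\<^sub>E {..<m}. \<forall>u v. {u, v} \<in> edges G \<longrightarrow> \<not> Q u (f u) v (f v)}"

lemma conflict_graph_edge_iff:
  assumes "\<And>u a v b. Q u a v b \<Longrightarrow> Q v b u a"
  shows "{(u, a), (v, b)} \<in> edges (conflict_graph G m Q) \<longleftrightarrow>
    u \<in> verts G \<and> v \<in> verts G \<and> a < m \<and> b < m \<and>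
      (u = v \<and> a \<noteq> b \<or> {u, v} \<in> edges G \<and> Q u a v b)"
  using assms by (auto simp: conflict_graph_def doubleton_eq_iff insert_commute)

text \<open>Functionality of \<open>Q\<close> from one side suffices for a matching, as symmetry
  turns it around.\<close>

lemma conflict_graph_m_fold_cover:
  assumes G: "simple_graph G" and m: "m \<ge> 1"
    and sym: "\<And>u a v b. Q u a v b \<Longrightarrow> Q v b u a"
    and match: "\<And>u a v b b'. {u, v} \<in> edges G \<Longrightarrow> a < m \<Longrightarrow> b < m \<Longrightarrow> b' < m \<Longrightarrow>
      Q u a v b \<Longrightarrow> Q u a v b' \<Longrightarrow> b = b'"
  shows "is_m_fold_cover G m (\<lambda>u. {u} \<times> {..<m}) (conflict_graph G m Q)"
proof -
  let ?H = "conflict_graph G m Q" and ?L = "\<lambda>u. {u} \<times> {..<m}"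
  note edge = conflict_graph_edge_iff[of Q, OF sym]
  have loop: "u \<noteq> v" if "{u, v} \<in> edges G" for u v
    using that G by (auto simp: simple_graph_def)
  have "simple_graph ?H"
    unfolding simple_graph_def
  proof (intro conjI ballI)
    show "finite (verts ?H)" using G by (simp add: simple_graph_def conflict_graph_def)
    fix e assume "e \<in> edges ?H"
    then obtain u a v b where "e = {(u, a), (v, b)}" "(u, a) \<noteq> (v, b)"
      "u \<in> verts G" "v \<in> verts G" "a < m" "b < m"
      using loop by (auto simp: conflict_graph_def)
    then show "e \<subseteq> verts ?H" "card e = 2" by (simp_all add: conflict_graph_def)
  qed
  moreover have "partition_on (verts ?H) (?L ` verts G)"
  proof -
    have "?L u \<noteq> {}" for u :: 'a using m by (auto simp: lessThan_empty_iff)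
    then have "{} \<notin> ?L ` verts G" by (simp add: image_iff eq_commute[of "{}"])
    then show ?thesis by (auto simp: partition_on_def disjoint_def conflict_graph_def)
  qed
  moreover have "card (?L ` verts G) = card (verts G)"
  proof (intro card_image inj_onI)
    fix u v :: 'a assume "?L u = ?L v"
    moreover have "(u, 0) \<in> ?L u" using m by simp
    ultimately show "u = v" by simp
  qed
  moreover have "{u, v} \<in> edges G" if "u \<noteq> v" "edges_between ?H (?L u) (?L v) \<noteq> {}" for u v
    using that by (auto simp: edges_between_def edge)
  moreover have "disjoint (edges_between ?H (?L u) (?L v))" if uv: "{u, v} \<in> edges G" for u v
  proof (rule disjointI)
    have endpoints: "\<exists>a b. e = {(u, a), (v, b)} \<and> a < m \<and> b < m \<and> Q u a v b"
      if mem: "e \<in> edges_between ?H (?L u) (?L v)" for e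
    proof -
      obtain a b where e: "e = {(u, a), (v, b)}" and lt: "a < m" "b < m" and "e \<in> edges ?H"
        using mem by (auto simp: edges_between_def)
      then have "Q u a v b" using loop[OF uv] by (simp add: edge)
      then show ?thesis using e lt by blast
    qed
    fix e e' assume "e \<in> edges_between ?H (?L u) (?L v)" "e' \<in> edges_between ?H (?L u) (?L v)"
      and ne: "e \<noteq> e'"
    then obtain a b a' b' where e: "e = {(u, a), (v, b)}" "e' = {(u, a'), (v, b')}"
      and lt: "a < m" "b < m" "a' < m" "b' < m" and Q: "Q u a v b" "Q u a' v b'"
      using endpoints by metis
    have "a \<noteq> a'" using match[of u v a b b'] uv lt Q ne e by auto
    moreover have "b \<noteq> b'"
      using match[of v u b a a'] uv lt sym[OF Q(1)] sym[OF Q(2)] ne e by (auto simp: insert_commute)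
    ultimately show "e \<inter> e' = {}" using loop[OF uv] e by auto
  qed
  ultimately show ?thesis
    by (auto simp: is_m_fold_cover_def is_cover_def edge)
qed

text \<open>An independent set meets every list at most once, since lists are complete; its size
  then forces exactly one element per list, so it is the graph of a coloring.\<close>

lemma card_cover_colorings_conflict_graph_le:
  assumes G: "simple_graph G" and sym: "\<And>u a v b. Q u a v b \<Longrightarrow> Q v b u a"
  shows "card (cover_colorings G (conflict_graph G m Q)) \<le> card (conflict_colorings G m Q)"
proof -
  let ?H = "conflict_graph G m Q"
  let ?F = "conflict_colorings G m Q"
  let ?img = "\<lambda>f. (\<lambda>u. (u, f u)) ` verts G"
  note edge = conflict_graph_edge_iff[of Q, OF sym]
  have finV: "finite (verts G)" using G by (simp add: simple_graph_def)
  have finF: "finite ?F"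
    by (rule finite_subset[of _ "verts G \<rightarrow>\<^sub>E {..<m}"])
      (auto simp: conflict_colorings_def intro: finite_PiE finV)
  have "cover_colorings G ?H \<subseteq> ?img ` ?F"
  proof
    fix I assume "I \<in> cover_colorings G ?H"
    then have sub: "I \<subseteq> verts G \<times> {..<m}"
      and indep: "\<And>p r. p \<in> I \<Longrightarrow> r \<in> I \<Longrightarrow> {p, r} \<notin> edges ?H"
      and card: "card I = card (verts G)"
      by (auto simp: cover_colorings_def independent_set_def conflict_graph_def)
    have uniq: "a = b" if ab: "(u, a) \<in> I" "(u, b) \<in> I" for u a b
    proof -
      have "u \<in> verts G" "a < m" "b < m" using ab sub by auto
      then show ?thesis using indep[OF ab] by (auto simp: edge)
    qed
    have "inj_on fst I" using uniq by (auto simp: inj_on_def)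
    then have "card (fst ` I) = card (verts G)" using card by (simp add: card_image)
    moreover have "fst ` I \<subseteq> verts G" using sub by auto
    ultimately have dom: "fst ` I = verts G" using finV by (simp add: card_subset_eq)
    define f where "f = (\<lambda>u\<in>verts G. THE a. (u, a) \<in> I)"
    have f: "f u = a" if "(u, a) \<in> I" for u a
    proof -
      have "u \<in> verts G" using that sub by auto
      then show ?thesis unfolding f_def using that uniq by (auto intro: the_equality)
    qed
    have fI: "(u, f u) \<in> I" if "u \<in> verts G" for u
    proof -
      have "u \<in> fst ` I" using that dom by simp
      then obtain a where "(u, a) \<in> I" by auto
      then show ?thesis using f by simp
    qed
    have "I = ?img f" using f fI sub by force
    moreover have "f \<in> ?F"
    proof -
      have "f \<in> verts G \<rightarrow>\<^sub>E {..<m}" using fI sub by (force simp: f_def)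
      moreover have "\<not> Q u (f u) v (f v)" if "{u, v} \<in> edges G" for u v
      proof -
        have "u \<in> verts G" "v \<in> verts G" using G that by (auto simp: simple_graph_def)
        then show ?thesis using indep[OF fI fI, of u v] that fI sub by (auto simp: edge)
      qed
      ultimately show ?thesis by (simp add: conflict_colorings_def)
    qed
    ultimately show "I \<in> ?img ` ?F" by blast
  qed
  then have "card (cover_colorings G ?H) \<le> card (?img ` ?F)"
    using finF by (intro card_mono) auto
  also have "\<dots> \<le> card ?F" using finF by (rule card_image_le)
  finally show ?thesis .
qed

lemma P_DP_le_card_conflict_colorings:
  assumes "simple_graph G" "m \<ge> 1"
    and "\<And>u a v b. Q u a v b \<Longrightarrow> Q v b u a"
    and "\<And>u a v b b'. {u, v} \<in> edges G \<Longrightarrow> a < m \<Longrightarrow> b < m \<Longrightarrow> b' < m \<Longrightarrow>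
      Q u a v b \<Longrightarrow> Q u a v b' \<Longrightarrow> b = b'"
  shows "P_DP G m \<le> card (conflict_colorings G m Q)"
proof -
  have "is_m_fold_cover G m (\<lambda>u. {u} \<times> {..<m}) (conflict_graph G m Q)"
    by (rule conflict_graph_m_fold_cover[OF assms])
  then have "P_DP G m \<le> card (cover_colorings G (conflict_graph G m Q))"
    by (rule P_DP_le)
  also have "\<dots> \<le> card (conflict_colorings G m Q)"
    by (rule card_cover_colorings_conflict_graph_le[OF assms(1,3)])
  finally show ?thesis .
qed

text \<open>Equality of colors as conflict relation gives the trivial cover, whose colorings are the
  proper ones.\<close>

lemma P_DP_le_chromatic_poly:
  assumes "simple_graph G" "m \<ge> 1"
  shows "P_DP G m \<le> chromatic_poly G m"
proof -
  have "conflict_colorings G m (\<lambda>u a v b. a = b) = proper_colorings G m"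
    by (simp add: conflict_colorings_def proper_colorings_def)
  then show ?thesis
    using P_DP_le_card_conflict_colorings[OF assms, of "\<lambda>u a v b. a = b"]
    by (simp add: chromatic_poly_def)
qed

subsection \<open>Wheels\<close>

definition wheel :: "nat \<Rightarrow> (nat + nat) graph" where
  "wheel n = graph_join (complete_graph 1) (cycle_graph n)"

lemma verts_wheel: "verts (wheel n) = insert (Inl 0) (Inr ` {..<n})"
  by (auto simp: wheel_def graph_join_def complete_graph_def cycle_graph_def)

lemma edges_wheel:
  "edges (wheel n) = {{Inr i, Inr ((i + 1) mod n)} | i. i < n} \<union> {{Inl 0, Inr i} | i. i < n}"
proof -
  have "card e \<noteq> 2" if "e \<subseteq> {..<1}" for e :: "nat set"
    using card_mono[OF _ that] by simp
  then have "edges (complete_graph 1) = {}" unfolding complete_graph_def by auto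
  moreover have "verts (complete_graph 1) = {0}" by (auto simp: complete_graph_def)
  moreover have "(\<lambda>e. Inr ` e) ` {{i, (i + 1) mod n} | i. i < n} =
      {{Inr i :: nat + nat, Inr ((i + 1) mod n)} | i. i < n}"
    by (simp add: setcompr_eq_image image_image)
  ultimately show ?thesis
    by (simp add: wheel_def graph_join_def cycle_graph_def)
qed

lemma neq_Suc_mod: "n \<ge> 2 \<Longrightarrow> i < n \<Longrightarrow> i \<noteq> Suc i mod n" for i n :: nat
  by (cases "Suc i = n") auto

text \<open>Keeps the two orientations of a rim edge apart; on two vertices, two steps would lead
  back to \<open>i\<close>.\<close>

lemma neq_Suc_Suc_mod: "n \<ge> 3 \<Longrightarrow> i < n \<Longrightarrow> i \<noteq> Suc (Suc i mod n) mod n" for i n :: nat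
  by (cases "Suc i = n"; cases "Suc (Suc i) = n") auto

lemma simple_graph_wheel:
  assumes "n \<ge> 2"
  shows "simple_graph (wheel n)"
  using assms neq_Suc_mod[of n] by (auto simp: simple_graph_def verts_wheel edges_wheel)

text \<open>Serves both proper colorings of the wheel and colorings of a concrete cover: splitting
  off the hub value gives an injection.\<close>

lemma card_le_twisted_colorings:
  assumes "n \<ge> 1" and F: "F \<subseteq> verts (wheel n) \<rightarrow>\<^sub>E {..<m}"
    and spoke: "\<And>f i. f \<in> F \<Longrightarrow> i < n \<Longrightarrow> f (Inr i) \<noteq> f (Inl 0)"
    and rim: "\<And>f i. f \<in> F \<Longrightarrow> i < n \<Longrightarrow> f (Inr ((i + 1) mod n)) \<noteq> \<sigma> i (f (Inr i))"
  shows "card F \<le> card (twisted_colorings n m \<sigma>)"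
proof (rule card_inj_on_le[of "\<lambda>f. (f (Inl 0), \<lambda>i\<in>{..<n}. f (Inr i))"])
  show "inj_on (\<lambda>f. (f (Inl 0), \<lambda>i\<in>{..<n}. f (Inr i))) F"
  proof (rule inj_onI)
    fix f g assume f: "f \<in> F" and g: "g \<in> F"
      and eq: "(f (Inl 0), \<lambda>i\<in>{..<n}. f (Inr i)) = (g (Inl 0), \<lambda>i\<in>{..<n}. g (Inr i))"
    from eq have "(\<lambda>i\<in>{..<n}. f (Inr i)) = (\<lambda>i\<in>{..<n}. g (Inr i))" by simp
    from fun_cong[OF this] have "f (Inr i) = g (Inr i)" if "i < n" for i
      using that by (metis lessThan_iff restrict_apply')
    then show "f = g"
      using eq f g F
      by (intro PiE_ext[of f "verts (wheel n)" "\<lambda>_. {..<m}" g]) (auto simp: verts_wheel)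
  qed
  show "(\<lambda>f. (f (Inl 0), \<lambda>i\<in>{..<n}. f (Inr i))) ` F \<subseteq> twisted_colorings n m \<sigma>"
  proof
    fix p assume "p \<in> (\<lambda>f. (f (Inl 0), \<lambda>i\<in>{..<n}. f (Inr i))) ` F"
    then obtain f where f: "f \<in> F" and p: "p = (f (Inl 0), \<lambda>i\<in>{..<n}. f (Inr i))" by blast
    have "f (Inl 0) < m" "\<And>i. i < n \<Longrightarrow> f (Inr i) < m"
      using f F by (auto simp: verts_wheel PiE_iff subset_iff)
    then show "p \<in> twisted_colorings n m \<sigma>"
      using assms(1) spoke[OF f] rim[OF f] by (auto simp: p twisted_colorings_def cyclic_seqs_def)
  qed
qed (rule finite_twisted_colorings)

lemma chromatic_poly_wheel_le:
  assumes "n \<ge> 1"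
  shows "chromatic_poly (wheel n) m \<le> card (twisted_colorings n m (\<lambda>_ x. x))"
  unfolding chromatic_poly_def
proof (rule card_le_twisted_colorings[OF assms])
  fix f i assume f: "f \<in> proper_colorings (wheel n) m" and "i < n"
  then have "{Inl 0, Inr i} \<in> edges (wheel n)" "{Inr i, Inr ((i + 1) mod n)} \<in> edges (wheel n)"
    by (auto simp: edges_wheel)
  then show "f (Inr i) \<noteq> f (Inl 0)" "f (Inr ((i + 1) mod n)) \<noteq> f (Inr i)"
    using f by (fastforce simp: proper_colorings_def)+
qed (auto simp: proper_colorings_def)

text \<open>Realizes given permutations by an actual cover, so that a particular twist bounds the
  minimum from above.\<close>

lemma P_DP_wheel_le:
  assumes n: "n \<ge> 3" and m: "m \<ge> 1"
    and \<sigma>: "\<And>i. i < n \<Longrightarrow> inj_on (\<sigma> i) {..<m}"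
  shows "P_DP (wheel n) m \<le> card (twisted_colorings n m \<sigma>)"
proof -
  \<comment> \<open>\<open>T\<close> orients each edge, spokes outward by equal colors and rim edges
    forward by \<open>\<sigma> i\<close>; \<open>Q\<close> forgets the orientation.\<close>
  define T where "T u a v b \<longleftrightarrow> (\<exists>i. u = Inl 0 \<and> v = Inr i \<and> a = b) \<or>
    (\<exists>i<n. u = Inr i \<and> v = Inr ((i + 1) mod n) \<and> b = \<sigma> i a)" for u v :: "nat + nat" and a b
  define Q where "Q u a v b \<longleftrightarrow> T u a v b \<or> T v b u a" for u a v b
  \<comment> \<open>As no edge carries conflicts in both directions, the matching condition splits
    into \<open>T\<close> being functional (\<open>out\<close>) and injective
    (\<open>into\<close>).\<close>
  have oriented: False if "T u a v b" "T v b' u a'" for u a v b a' b'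
    using that neq_Suc_Suc_mod[OF n] by (auto simp: T_def)
  have out: "b = b'" if "T u a v b" "T u a v b'" for u a v b b'
    using that by (auto simp: T_def)
  have into: "b = b'" if "T v b u a" "T v b' u a" "b < m" "b' < m" for u a v b b'
    using that \<sigma> by (auto simp: T_def dest: inj_onD)
  have "P_DP (wheel n) m \<le> card (conflict_colorings (wheel n) m Q)"
  proof (rule P_DP_le_card_conflict_colorings)
    show "simple_graph (wheel n)" using n by (intro simple_graph_wheel) simp
    show "m \<ge> 1" by (rule m)
    show "Q v b u a" if "Q u a v b" for u a v b using that by (auto simp: Q_def)
    show "b = b'" if "b < m" "b' < m" "Q u a v b" "Q u a v b'" for u a v b b'
      using that oriented out into unfolding Q_def by blast
  qed
  also have "\<dots> \<le> card (twisted_colorings n m \<sigma>)"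
  proof (rule card_le_twisted_colorings)
    fix f i assume f: "f \<in> conflict_colorings (wheel n) m Q" and i: "i < n"
    then have "{Inl 0, Inr i} \<in> edges (wheel n)" "{Inr i, Inr ((i + 1) mod n)} \<in> edges (wheel n)"
      by (auto simp: edges_wheel)
    then have "\<not> Q (Inl 0) (f (Inl 0)) (Inr i) (f (Inr i))"
      "\<not> Q (Inr i) (f (Inr i)) (Inr ((i + 1) mod n)) (f (Inr ((i + 1) mod n)))"
      using f by (auto simp: conflict_colorings_def)
    then show "f (Inr i) \<noteq> f (Inl 0)" "f (Inr ((i + 1) mod n)) \<noteq> \<sigma> i (f (Inr i))"
      using i by (auto simp: Q_def T_def)
  qed (use n in \<open>auto simp: conflict_colorings_def\<close>)
  finally show ?thesis .
qed

lemma cover_of_wheel_twisted_colorings_le: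
  assumes n: "n \<ge> 2" and cov: "is_m_fold_cover (wheel n) m L H"
  shows "\<exists>\<sigma>. (\<forall>i<n. bij_betw (\<sigma> i) {..<m} {..<m}) \<and>
    card (twisted_colorings n m \<sigma>) \<le> card (cover_colorings (wheel n) H)"
proof -
  have cov': "is_cover (wheel n) L H" using cov by (simp add: is_m_fold_cover_def)
  have fin: "finite (verts (wheel n))" by (simp add: verts_wheel)
  have "finite (verts H)" "L (Inl 0) \<subseteq> verts H"
    using cov' by (auto simp: is_cover_def simple_graph_def partition_on_def verts_wheel)
  then have "finite (L (Inl 0))" by (rule finite_subset[rotated])
  moreover have "card (L (Inl 0)) = m" using cov by (simp add: is_m_fold_cover_def verts_wheel)
  ultimately obtain hub where hub: "bij_betw hub {..<m} (L (Inl 0))"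
    using finite_same_card_bij[of "{..<m}" "L (Inl 0)"] by auto
  have "\<forall>i\<in>{..<n}. \<exists>\<beta>. bij_betw \<beta> (L (Inl 0)) (L (Inr i)) \<and>
      (\<forall>x\<in>L (Inl 0). \<forall>y\<in>L (Inr i). {x, y} \<in> edges H \<longrightarrow> \<beta> x = y)"
    by (intro ballI m_fold_cover_edge_bij[OF cov fin]) (auto simp: verts_wheel edges_wheel)
  then obtain spoke where spoke: "\<And>i. i < n \<Longrightarrow> bij_betw (spoke i) (L (Inl 0)) (L (Inr i))"
    and spoke_edge: "\<And>i x y. i < n \<Longrightarrow> x \<in> L (Inl 0) \<Longrightarrow> y \<in> L (Inr i) \<Longrightarrow>
      {x, y} \<in> edges H \<Longrightarrow> spoke i x = y"
    by (auto dest!: bchoice)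
  have "\<forall>i\<in>{..<n}. \<exists>\<beta>. bij_betw \<beta> (L (Inr i)) (L (Inr ((i + 1) mod n))) \<and>
      (\<forall>x\<in>L (Inr i). \<forall>y\<in>L (Inr ((i + 1) mod n)). {x, y} \<in> edges H \<longrightarrow> \<beta> x = y)"
    using n neq_Suc_mod[OF n]
    by (intro ballI m_fold_cover_edge_bij[OF cov fin]) (auto simp: verts_wheel edges_wheel)
  then obtain rim where rim: "\<And>i. i < n \<Longrightarrow> bij_betw (rim i) (L (Inr i)) (L (Inr ((i + 1) mod n)))"
    and rim_edge: "\<And>i x y. i < n \<Longrightarrow> x \<in> L (Inr i) \<Longrightarrow> y \<in> L (Inr ((i + 1) mod n)) \<Longrightarrow>
      {x, y} \<in> edges H \<Longrightarrow> rim i x = y"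
    by (auto dest!: bchoice)
  \<comment> \<open>\<open>lab i\<close> names a color at rim vertex \<open>i\<close> after the hub
    color matched to it, so every spoke becomes the identity and \<open>\<sigma> i\<close> is the
    rim matching in these names.\<close>
  define lab where "lab i = spoke i \<circ> hub" for i
  have lab: "bij_betw (lab i) {..<m} (L (Inr i))" if "i < n" for i
    unfolding lab_def using hub spoke[OF that] by (rule bij_betw_trans)
  define \<sigma> where "\<sigma> i = inv_into {..<m} (lab ((i + 1) mod n)) \<circ> (rim i \<circ> lab i)" for i
  have next_lt: "(i + 1) mod n < n" for i using n by simp
  have bij_\<sigma>: "bij_betw (\<sigma> i) {..<m} {..<m}" if "i < n" for i
    unfolding \<sigma>_def
    by (intro bij_betw_trans[OF bij_betw_trans[OF lab rim] bij_betw_inv_into[OF lab]] that next_lt)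
  have lab_\<sigma>: "lab ((i + 1) mod n) (\<sigma> i x) = rim i (lab i x)" if "i < n" "x < m" for i x
  proof -
    have "rim i (lab i x) \<in> L (Inr ((i + 1) mod n))"
      using that by (intro bij_betwE[OF rim, rule_format] bij_betwE[OF lab, rule_format]) auto
    then show ?thesis
      unfolding \<sigma>_def comp_apply by (rule bij_betw_inv_into_right[OF lab[OF next_lt]])
  qed
  define \<phi> where "\<phi> p = (\<lambda>v\<in>verts (wheel n).
    case v of Inl _ \<Rightarrow> hub (fst p) | Inr i \<Rightarrow> lab i (snd p i))"
    for p
  have \<phi>_hub: "\<phi> p (Inl 0) = hub (fst p)" for p
    by (simp add: \<phi>_def verts_wheel)
  have \<phi>_rim: "\<phi> p (Inr i) = lab i (snd p i)" if "i < n" for p i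
    using that by (simp add: \<phi>_def verts_wheel)
  have "card (twisted_colorings n m \<sigma>) \<le> card (transversals (wheel n) L H)"
  proof (rule card_inj_on_le[of \<phi>])
    show "inj_on \<phi> (twisted_colorings n m \<sigma>)"
    proof (rule inj_onI)
      fix p p' assume p: "p \<in> twisted_colorings n m \<sigma>" "p' \<in> twisted_colorings n m \<sigma>"
        and eq: "\<phi> p = \<phi> p'"
      have "fst p = fst p'"
        using fun_cong[OF eq, of "Inl 0"] p hub
        by (auto simp: \<phi>_hub twisted_colorings_def bij_betw_def inj_on_def)
      moreover have "snd p = snd p'"
      proof (rule PiE_ext)
        show "snd p \<in> {..<n} \<rightarrow>\<^sub>E {..<m}" "snd p' \<in> {..<n} \<rightarrow>\<^sub>E {..<m}"
          using p by (auto simp: twisted_colorings_def cyclic_seqs_def PiE_iff)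
        then show "snd p i = snd p' i" if "i \<in> {..<n}" for i
          using fun_cong[OF eq, of "Inr i"] lab[of i] that
          by (auto simp: \<phi>_rim bij_betw_def inj_on_def PiE_iff)
      qed
      ultimately show "p = p'" by (simp add: prod_eq_iff)
    qed
    show "\<phi> ` twisted_colorings n m \<sigma> \<subseteq> transversals (wheel n) L H"
    proof
      fix f assume "f \<in> \<phi> ` twisted_colorings n m \<sigma>"
      then obtain c x where f: "f = \<phi> (c, x)" and c: "c < m"
        and x: "\<And>i. i < n \<Longrightarrow> x i < m" "\<And>i. i < n \<Longrightarrow> x i \<noteq> c"
          "\<And>i. i < n \<Longrightarrow> x ((i + 1) mod n) \<noteq> \<sigma> i (x i)"
        by (auto simp: twisted_colorings_def cyclic_seqs_def PiE_iff)
      have hub_mem: "hub c \<in> L (Inl 0)" using bij_betwE[OF hub] c by simp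
      have lab_mem: "lab i (x i) \<in> L (Inr i)" if "i < n" for i
        using bij_betwE[OF lab[OF that]] x(1)[OF that] by simp
      have spoke_ok: "{hub c, lab i (x i)} \<notin> edges H" if "i < n" for i
      proof
        assume "{hub c, lab i (x i)} \<in> edges H"
        then have "lab i c = lab i (x i)"
          using spoke_edge[OF that hub_mem lab_mem[OF that]] by (simp add: lab_def)
        then show False
          using lab[OF that] c x(1,2)[OF that] by (auto simp: bij_betw_def inj_on_def)
      qed
      have rim_ok: "{lab i (x i), lab ((i + 1) mod n) (x ((i + 1) mod n))} \<notin> edges H"
        if "i < n" for i
      proof
        assume "{lab i (x i), lab ((i + 1) mod n) (x ((i + 1) mod n))} \<in> edges H"
        then have "lab ((i + 1) mod n) (\<sigma> i (x i)) = lab ((i + 1) mod n) (x ((i + 1) mod n))"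
          using rim_edge[OF that lab_mem[OF that] lab_mem[OF next_lt]] lab_\<sigma>[OF that x(1)[OF that]]
          by simp
        moreover have "\<sigma> i (x i) < m"
          using bij_betwE[OF bij_\<sigma>[OF that]] x(1)[OF that] by simp
        ultimately show False
          using lab[OF next_lt] x(1)[OF next_lt] x(3)[OF that] unfolding bij_betw_def
          by (metis inj_onD lessThan_iff)
      qed
      have "f \<in> Pi\<^sub>E (verts (wheel n)) L"
        using hub_mem lab_mem by (auto simp: f \<phi>_def verts_wheel)
      moreover have "{f u, f v} \<notin> edges H" if "{u, v} \<in> edges (wheel n)" for u v
        using that unfolding edges_wheel
      proof (elim UnE CollectE exE conjE)
        fix i assume "{u, v} = {Inr i, Inr ((i + 1) mod n)}" "i < n"
        then have "f ` {u, v} = {lab i (x i), lab ((i + 1) mod n) (x ((i + 1) mod n))}"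
          using next_lt[of i] by (simp add: f \<phi>_rim)
        then show ?thesis using rim_ok[OF \<open>i < n\<close>] by simp
      next
        fix i assume "{u, v} = {Inl 0, Inr i}" "i < n"
        then have "f ` {u, v} = {hub c, lab i (x i)}"
          by (simp add: f \<phi>_rim \<phi>_hub)
        then show ?thesis using spoke_ok[OF \<open>i < n\<close>] by simp
      qed
      ultimately show "f \<in> transversals (wheel n) L H"
        by (simp add: transversals_def)
    qed
    have "finite (Pi\<^sub>E (verts (wheel n)) L)"
      using cov' fin \<open>finite (verts H)\<close>
      by (intro finite_PiE) (auto simp: is_cover_def partition_on_def intro: finite_subset)
    then show "finite (transversals (wheel n) L H)"
      by (rule finite_subset[rotated]) (auto simp: transversals_def)
  qed
  also have "\<dots> \<le> card (cover_colorings (wheel n) H)"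
    by (rule card_transversals_le[OF cov' fin])
  finally show ?thesis using bij_\<sigma> by blast
qed

section \<open>Bounds for wheels\<close>

lemma P_DP_wheel_ge:
  assumes "n \<ge> 2" "m \<ge> 1"
  shows "\<exists>\<sigma>. (\<forall>i<n. bij_betw (\<sigma> i) {..<m} {..<m}) \<and>
    card (twisted_colorings n m \<sigma>) \<le> P_DP (wheel n) m"
proof -
  obtain L and H :: "nat graph" where "is_m_fold_cover (wheel n) m L H"
    and "P_DP (wheel n) m = card (cover_colorings (wheel n) H)"
    using P_DP_attained[OF simple_graph_wheel[OF assms(1)] assms(2)] by blast
  then show ?thesis
    using cover_of_wheel_twisted_colorings_le[OF assms(1)] by simp
qed

text \<open>An upper bound on the chromatic polynomial is what closes the chain: where the lower
  bound on \<open>P_DP\<close> reaches the same value, all three numbers coincide.\<close>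

lemma P_DP_wheel_le_chromatic:
  assumes "n \<ge> 2" "m \<ge> 1"
  shows "P_DP (wheel n) m \<le> chromatic_poly (wheel n) m"
    and "int (chromatic_poly (wheel n) m) \<le>
      int m * ((int m - 2) ^ n + (- 1) ^ n * (int m - 2))"
proof -
  show "P_DP (wheel n) m \<le> chromatic_poly (wheel n) m"
    by (intro P_DP_le_chromatic_poly simple_graph_wheel assms)
  have "chromatic_poly (wheel n) m \<le> card (twisted_colorings n m (\<lambda>_ x. x))"
    using assms by (intro chromatic_poly_wheel_le) simp
  then show "int (chromatic_poly (wheel n) m) \<le>
      int m * ((int m - 2) ^ n + (- 1) ^ n * (int m - 2))"
    using card_twisted_colorings_id[of n m] assms by linarith
qed

lemma P_DP_odd_wheel:
  assumes "odd n" "n \<ge> 2" "m \<ge> 1"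
  shows "P_DP (wheel n) m = chromatic_poly (wheel n) m"
proof -
  obtain \<sigma> where "\<And>i. i < n \<Longrightarrow> bij_betw (\<sigma> i) {..<m} {..<m}"
    and le: "card (twisted_colorings n m \<sigma>) \<le> P_DP (wheel n) m"
    using P_DP_wheel_ge[OF assms(2,3)] by blast
  then have "int (card (twisted_colorings n m \<sigma>)) \<ge> int m * ((int m - 2) ^ n - (int m - 2))"
    using assms(1) by (intro card_twisted_colorings_ge_odd)
  then show ?thesis
    using le P_DP_wheel_le_chromatic[OF assms(2,3)] assms(1) by (simp add: algebra_simps)
qed

lemma P_DP_even_wheel_ge:
  assumes "even n" "n \<ge> 2" "m \<ge> 1"
  shows "\<exists>d\<le>m. int (P_DP (wheel n) m) \<ge>
    int m * ((int m - 2) ^ n + (int m - 2))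
      + int d * (walk_number (int m - 2) (n - 1) - (int m - 1))"
proof -
  obtain \<sigma> where \<sigma>: "\<And>i. i < n \<Longrightarrow> bij_betw (\<sigma> i) {..<m} {..<m}"
    and le: "card (twisted_colorings n m \<sigma>) \<le> P_DP (wheel n) m"
    using P_DP_wheel_ge[OF assms(2,3)] by blast
  obtain d where "d \<le> m" "int (card (twisted_colorings n m \<sigma>)) \<ge>
    int m * ((int m - 2) ^ n + (int m - 2))
      + int d * (walk_number (int m - 2) (n - 1) - (int m - 1))"
    using card_twisted_colorings_ge_even[of n \<sigma> m, OF \<sigma>] assms by auto
  then show ?thesis using le by (intro exI[of _ d] conjI) linarith+
qed

lemma P_DP_even_wheel_ge_4:
  assumes "even n" "n \<ge> 4" "m \<ge> 4"
  shows "P_DP (wheel n) m = chromatic_poly (wheel n) m"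
proof -
  have n: "n \<ge> 2" and m: "m \<ge> 1" using assms by auto
  obtain d where "int (P_DP (wheel n) m) \<ge> int m * ((int m - 2) ^ n + (int m - 2))
      + int d * (walk_number (int m - 2) (n - 1) - (int m - 1))"
    using P_DP_even_wheel_ge[OF assms(1) n m] by blast
  \<comment> \<open>Here \<open>n - 1 \<ge> 3\<close> is odd and \<open>q = m - 2 \<ge> 2\<close>,
    so moved colors cannot lower the bound.\<close>
  moreover have "walk_number (int m - 2) (n - 1) \<ge> int m - 1"
    using walk_number_odd_ge[of "int m - 2" "n - 1"] assms by simp
  then have "int d * (walk_number (int m - 2) (n - 1) - (int m - 1)) \<ge> 0" by simp
  ultimately show ?thesis
    using P_DP_wheel_le_chromatic[OF n m] assms(1) by simp
qed

lemma P_DP_even_wheel_3: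
  assumes "even n" "n \<ge> 4"
  shows "P_DP (wheel n) 3 = 3"
proof (rule antisym)
  have "inj_on (\<lambda>x. if i = n - 1 then (x + 1) mod 3 else x) {..<3::nat}" for i
    by (auto simp: inj_on_def mod_Suc)
  then have "P_DP (wheel n) 3 \<le>
      card (twisted_colorings n 3 (\<lambda>i x. if i = n - 1 then (x + 1) mod 3 else x))"
    using assms by (intro P_DP_wheel_le) simp_all
  then show "P_DP (wheel n) 3 \<le> 3"
    using card_twisted_colorings_3[of n] assms by simp
  \<comment> \<open>With \<open>q = 1\<close> the gain is 1 and the general bound reads
    \<open>3 * (1 + 1) + d * (1 - 2)\<close>, at least 3 since \<open>d \<le> 3\<close>.\<close>
  obtain d where "d \<le> 3" "int (P_DP (wheel n) 3) \<ge> 6 - int d"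
    using P_DP_even_wheel_ge[of n 3] assms walk_number_1_odd[of "n - 1"] by auto
  then show "3 \<le> P_DP (wheel n) 3" by linarith
qed

text \<open>The polynomial for even \<open>n\<close> vanishes: \<open>(- 1) ^ n - 1 = 0\<close> for
  \<open>m = 1\<close> and \<open>0 ^ n + 0 = 0\<close> for \<open>m = 2\<close>.\<close>

lemma P_DP_even_wheel_le_2:
  assumes "even n" "n \<ge> 2" "m \<in> {1, 2}"
  shows "P_DP (wheel n) m = 0"
  using P_DP_wheel_le_chromatic[of n m] assms by (auto simp: zero_power)

theorem theorem1p8:
  fixes k m :: nat
  assumes "k \<ge> 1" and "m \<ge> 1"
  shows "P_DP (graph_join (complete_graph 1) (cycle_graph (2 * k + 1))) m
           = chromatic_poly (graph_join (complete_graph 1) (cycle_graph (2 * k + 1))) m \<and>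
         P_DP (graph_join (complete_graph 1) (cycle_graph (2 * k + 2))) m
           = (if m \<in> {1, 2} then 0
              else if m = 3 then 3
              else chromatic_poly (graph_join (complete_graph 1) (cycle_graph (2 * k + 2))) m)"
proof -
  have "m \<ge> 4" if "m \<notin> {1, 2}" "m \<noteq> 3" using that assms(2) by auto
  then show ?thesis
    using assms P_DP_odd_wheel[of "2 * k + 1" m] P_DP_even_wheel_le_2[of "2 * k + 2" m]
      P_DP_even_wheel_3[of "2 * k + 2"] P_DP_even_wheel_ge_4[of "2 * k + 2" m]
    unfolding wheel_def by simp
qed

end
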